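(* For every channel with state $(\mathcal{N},P_S)$ over finite alphabets $(\mathcal{X},\mathcal{Y},\mathcal{S})$, the non-signaling-assisted capacity with causal CSIT satisfies $$C^{\mathrm{NS},\mathrm{ca}}(\mathcal{N},P_S)=\max_{P_{X\mid S}} I(X;Y\mid S),$$ where the maximum is over all conditional distributions $P_{X\mid S}$ of $X$ given $S$, and the mutual information is computed under the joint distribution $P_{SXY}(s,x,y)=P_S(s)P_{X\mid S}(x\mid s)\mathcal{N}(y\mid x,s)$.
   Context: A channel with state $(\mathcal{N},P_S)$ consists of finite sets $\mathcal{X}$ (input), $\mathcal{Y}$ (output), $\mathcal{S}$ (state), a conditional distribution $\mathcal{N}(y\mid x,s)$, and a state distribution $P_S$ on $\mathcal{S}$. Over $n$ uses, states are i.i.d., $P_S^{\otimes n}(s^n)=\prod_{i=1}^n P_S(s_i)$, and the channel is memoryless, $\mathcal{N}^{\otimes n}(y^n\mid x^n,s^n)=\prod_{i=1}^n\mathcal{N}(y_i\mid x_i,s_i)$. Notation: $x^i=(x_1,\dots,x_i)$, $x_{i+1}^n=(x_{i+1},\dots,x_n)$, $[M]=\{1,\dots,M\}$. A non-signaling (NS)-assisted coding scheme with causal CSIT, with message size $M\in\mathbb{N}$ and blocklength $n\in\mathbb{N}$, is a conditional distribution $Z(x^n,\hat w\mid w,s^n,y^n)$ on $\mathcal{X}^n\times[M]$ given $(w,s^n,y^n)\in[M]\times\mathcal{S}^n\times\mathcal{Y}^n$ such that, with marginals taken in the obvious way: (C1) the marginal $Z(x^n\mid w,s^n,y^n)=\sum_{\hat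 w}Z(x^n,\hat w\mid w,s^n,y^n)$ does not depend on $y^n$; (C2) the marginal $Z(\hat w\mid w,s^n,y^n)=\sum_{x^n}Z(x^n,\hat w\mid w,s^n,y^n)$ does not depend on $(w,s^n)$; (C3) for every $i\in[n-1]$, the marginal $Z(x^i,\hat w\mid w,s^n,y^n)=\sum_{x_{i+1}^n}Z(x^n,\hat w\mid w,s^n,y^n)$ does not depend on $s_{i+1}^n$. Its success probability is $$\eta(Z)=\frac1M\sum_{w\in[M]}\sum_{x^n,s^n,y^n}P_S^{\otimes n}(s^n)\,\mathcal{N}^{\otimes n}(y^n\mid x^n,s^n)\,Z(x^n,w\mid w,s^n,y^n).$$ A rate $R\ge0$ is achievable if there is a sequence of such schemes $Z_n$ with message sizes $M_n$ and blocklength $n$ such that $\lim_{n\to\infty}\eta(Z_n)=1$ and $\lim_{n\to\infty}\frac{\log_2 M_n}{n}\ge R$. The NS-assisted capacity with causal CSIT $C^{\mathrm{NS},\mathrm{ca}}(\mathcal{N},P_S)$ is the supremum of achievable rates. *)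

theory Defs
  imports "HOL-Analysis.Analysis"
begin

text \<open>Sequences of length n are lists of length n; position i (0-based) is the (i+1)-th use.\<close>

definition seqs :: "nat \<Rightarrow> 'a list set" where
  "seqs n = {xs. length xs = n}"

definition is_distr :: "('a::finite \<Rightarrow> real) \<Rightarrow> bool" where
  "is_distr P \<longleftrightarrow> (\<forall>a. P a \<ge> 0) \<and> (\<Sum>a\<in>UNIV. P a) = 1"

definition is_channel :: "('x::finite \<Rightarrow> 's::finite \<Rightarrow> 'y::finite \<Rightarrow> real) \<Rightarrow> bool" where
  "is_channel N \<longleftrightarrow> (\<forall>x s. is_distr (N x s))"

definition PSn :: "('s \<Rightarrow> real) \<Rightarrow> 's list \<Rightarrow> real" where
  "PSn P ss = (\<Prod>i<length ss. P (ss ! i))"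

definition Nn :: "('x \<Rightarrow> 's \<Rightarrow> 'y \<Rightarrow> real) \<Rightarrow> 'x list \<Rightarrow> 's list \<Rightarrow> 'y list \<Rightarrow> real" where
  "Nn N xs ss ys = (\<Prod>i<length xs. N (xs ! i) (ss ! i) (ys ! i))"

text \<open>A NS-assisted code with causal CSIT: Z xs w' w ss ys = Z(x^n, w' | w, s^n, y^n),
  messages in [M] = {1..M}.\<close>

definition NS_causal_code ::
  "nat \<Rightarrow> nat \<Rightarrow> ('x::finite list \<Rightarrow> nat \<Rightarrow> nat \<Rightarrow> 's::finite list \<Rightarrow> 'y::finite list \<Rightarrow> real) \<Rightarrow> bool" where
  "NS_causal_code M n Z \<longleftrightarrow>
     \<comment> \<open>conditional distribution\<close>
     (\<forall>w\<in>{1..M}. \<forall>ss\<in>seqs n. \<forall>ys\<in>seqs n.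
        (\<forall>xs\<in>seqs n. \<forall>w'\<in>{1..M}. Z xs w' w ss ys \<ge> 0) \<and>
        (\<Sum>xs\<in>seqs n. \<Sum>w'\<in>{1..M}. Z xs w' w ss ys) = 1) \<and>
     \<comment> \<open>(C1)\<close>
     (\<forall>w\<in>{1..M}. \<forall>ss\<in>seqs n. \<forall>ys\<in>seqs n. \<forall>ys'\<in>seqs n. \<forall>xs\<in>seqs n.
        (\<Sum>w'\<in>{1..M}. Z xs w' w ss ys) = (\<Sum>w'\<in>{1..M}. Z xs w' w ss ys')) \<and>
     \<comment> \<open>(C2)\<close>
     (\<forall>w\<in>{1..M}. \<forall>v\<in>{1..M}. \<forall>ss\<in>seqs n. \<forall>ss'\<in>seqs n. \<forall>ys\<in>seqs n. \<forall>w'\<in>{1..M}.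
        (\<Sum>xs\<in>seqs n. Z xs w' w ss ys) = (\<Sum>xs\<in>seqs n. Z xs w' v ss' ys)) \<and>
     \<comment> \<open>(C3): for i in [n-1], marginal on (x^i, w') does not depend on s_{i+1}^n\<close>
     (\<forall>i\<in>{1..n-1}. \<forall>w\<in>{1..M}. \<forall>ss\<in>seqs n. \<forall>ss'\<in>seqs n. \<forall>ys\<in>seqs n.
        \<forall>xp\<in>seqs i. \<forall>w'\<in>{1..M}.
        take i ss = take i ss' \<longrightarrow>
        (\<Sum>xr\<in>seqs (n - i). Z (xp @ xr) w' w ss ys) =
        (\<Sum>xr\<in>seqs (n - i). Z (xp @ xr) w' w ss' ys))"

definition success_prob ::
  "('x::finite \<Rightarrow> 's::finite \<Rightarrow> 'y::finite \<Rightarrow> real) \<Rightarrow> ('s \<Rightarrow> real) \<Rightarrow> nat \<Rightarrow> nat \<Rightarrow>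
   ('x list \<Rightarrow> nat \<Rightarrow> nat \<Rightarrow> 's list \<Rightarrow> 'y list \<Rightarrow> real) \<Rightarrow> real" where
  "success_prob N P M n Z =
     (1 / real M) * (\<Sum>w\<in>{1..M}. \<Sum>xs\<in>seqs n. \<Sum>ss\<in>seqs n. \<Sum>ys\<in>seqs n.
        PSn P ss * Nn N xs ss ys * Z xs w w ss ys)"

definition achievable_NS_causal ::
  "('x::finite \<Rightarrow> 's::finite \<Rightarrow> 'y::finite \<Rightarrow> real) \<Rightarrow> ('s \<Rightarrow> real) \<Rightarrow> real \<Rightarrow> bool" where
  "achievable_NS_causal N P R \<longleftrightarrow> R \<ge> 0 \<and>
     (\<exists>(M :: nat \<Rightarrow> nat) (Z :: nat \<Rightarrow> 'x list \<Rightarrow> nat \<Rightarrow> nat \<Rightarrow> 's list \<Rightarrow> 'y list \<Rightarrow> real) L.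
        (\<forall>n. M n \<ge> 1 \<and> NS_causal_code (M n) n (Z n)) \<and>
        (\<lambda>n. success_prob N P (M n) n (Z n)) \<longlonglongrightarrow> 1 \<and>
        (\<lambda>n. log 2 (real (M n)) / real n) \<longlonglongrightarrow> L \<and> L \<ge> R)"

definition capacity_NS_causal ::
  "('x::finite \<Rightarrow> 's::finite \<Rightarrow> 'y::finite \<Rightarrow> real) \<Rightarrow> ('s \<Rightarrow> real) \<Rightarrow> real" where
  "capacity_NS_causal N P = Sup {R. achievable_NS_causal N P R}"

definition cond_mutual_info ::
  "('x::finite \<Rightarrow> 's::finite \<Rightarrow> 'y::finite \<Rightarrow> real) \<Rightarrow> ('s \<Rightarrow> real) \<Rightarrow> ('s \<Rightarrow> 'x \<Rightarrow> real) \<Rightarrow> real" where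
  "cond_mutual_info N P Q =
     (let Psxy = (\<lambda>s x y. P s * Q s x * N x s y);
          Psx = (\<lambda>s x. \<Sum>y\<in>UNIV. Psxy s x y);
          Psy = (\<lambda>s y. \<Sum>x\<in>UNIV. Psxy s x y)
      in \<Sum>s\<in>UNIV. \<Sum>x\<in>UNIV. \<Sum>y\<in>UNIV.
           (if Psxy s x y = 0 then 0
            else Psxy s x y * log 2 (Psxy s x y * P s / (Psx s x * Psy s y))))"

end

theory Submission
  imports Defs "HOL-Real_Asymp.Real_Asymp"
begin

text \<open>
  Achievability. Let \<open>q(y|s)\<close> be the output distribution and \<open>r = N(y|x,s) / q(y|s)\<close> the
  exponential of the information density. A code is obtained from any \<open>D(x^n, y^n | s^n)\<close> with
  \<open>0 \<le> D \<le> Q(x^n|s^n)\<close> whose sum over \<open>x^n\<close> is \<open>1/M\<close> and whose prefix marginals are causal in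
  \<open>s^n\<close>: use \<open>D\<close> when the decoded message is correct and spread \<open>Q - D\<close> over the wrong ones. We
  take \<open>D = Q u_n\<close>, where \<open>u\<close> is the wealth of a gambler who starts with \<open>1/M\<close>, bets causally at
  the odds \<open>r\<close> (fair under \<open>Q\<close>), and never exceeds \<open>1\<close>. The success probability is the
  expectation of \<open>u_n\<close> under the true channel law, under which the bets are favourable: the
  logarithm of \<open>u\<close> grows by \<open>I(X;Y|S)\<close> per step on average, and once \<open>u\<close> is bounded below, the
  potential \<open>u powr (- c) - 1\<close> contracts geometrically in expectation.

  Converse. Averaging over correct messages turns a code into such a \<open>D\<close>, that is, into a test
  between the channel output law and any reference law of \<open>y^n\<close> given \<open>s^n\<close>. With the product of
  the capacity-achieving output laws of the channels \<open>N(y|x,s)\<close> as reference, the optimality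
  conditions bound the divergence for each fixed \<open>x^n, s^n\<close>, so that no single-letterization is
  needed.
\<close>

section \<open>Capped betting at favourable odds\<close>

text \<open>A gambler with wealth \<open>u\<close> (as a fraction of the target) stakes the largest amount that cannot
  carry the wealth above \<open>1\<close> when the payoff ratio \<open>r\<close> is at most \<open>K\<close>.\<close>

definition bet :: "real \<Rightarrow> real \<Rightarrow> real \<Rightarrow> real" where
  "bet K u r = u + min u ((1 - u) / (K - 1)) * (r - 1)"

lemma bet_nonneg:
  assumes "K > 1" "0 \<le> u" "u \<le> 1" "0 \<le> r"
  shows "0 \<le> bet K u r"
proof -
  define m where "m = min u ((1 - u) / (K - 1))"
  have m: "0 \<le> m" "m \<le> u" using assms by (auto simp: m_def)
  have "bet K u r = (u - m) + m * r" by (simp add: bet_def m_def algebra_simps)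
  thus ?thesis using m assms by simp
qed

lemma bet_pos:
  assumes "K > 1" "0 < u" "u \<le> 1" "0 < r"
  shows "0 < bet K u r"
proof -
  define m where "m = min u ((1 - u) / (K - 1))"
  have m: "0 \<le> m" "m \<le> u" using assms by (auto simp: m_def)
  have "bet K u r = (u - m) + m * r" by (simp add: bet_def m_def algebra_simps)
  moreover have "m * r > 0" if "m > 0" using that assms by simp
  ultimately show ?thesis using m assms by (cases "m = 0") (auto intro: add_nonneg_pos)
qed

lemma bet_le_1:
  assumes "K > 1" "0 \<le> u" "u \<le> 1" "r \<le> K"
  shows "bet K u r \<le> 1"
proof -
  define m where "m = min u ((1 - u) / (K - 1))"
  have m: "0 \<le> m" "m \<le> (1 - u) / (K - 1)" using assms by (auto simp: m_def)
  have "m * (r - 1) \<le> m * (K - 1)" using m assms by (intro mult_left_mono) auto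
  also have "\<dots> \<le> 1 - u" using m(2) assms by (simp add: field_simps)
  finally show ?thesis by (simp add: bet_def m_def)
qed

lemma bet_one [simp]: "K > 1 \<Longrightarrow> bet K 1 r = 1"
  by (simp add: bet_def)

text \<open>Concavity of \<open>ln\<close> inside the exponent, then convexity of
  \<open>exp\<close>. This compares staking a fraction \<open>t\<close> with mixing no stake and
  full stake.\<close>

lemma powr_neg_convex:
  fixes r t c :: real
  assumes "0 < r" "0 \<le> t" "t \<le> 1" "0 \<le> c"
  shows "(1 - t + t * r) powr (- c) \<le> 1 - t + t * r powr (- c)"
proof -
  have pos: "1 - t + t * r > 0"
    using assms by (cases "t = 1") (auto intro: add_pos_nonneg)
  have "(1 - t) * ln 1 + t * ln r \<le> ln ((1 - t) * 1 + t * r)"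
    using convex_onD[OF ln_concave[unfolded concave_on_def], of t 1 r] assms by simp
  hence "- c * ln (1 - t + t * r) \<le> - c * (t * ln r)"
    using assms by (simp add: mult_left_mono)
  hence "(1 - t + t * r) powr (- c) \<le> exp ((1 - t) * 0 + t * (- c * ln r))"
    using pos by (simp add: powr_def mult_ac)
  also have "\<dots> \<le> (1 - t) * exp 0 + t * exp (- c * ln r)"
    using convex_onD[OF exp_convex, of t 0 "- c * ln r"] assms by simp
  finally show ?thesis using assms by (simp add: powr_def)
qed

text \<open>The stake is the fraction \<open>t = min 1 ((1 / u - 1) / (K - 1))\<close> of the
  wealth, so a bet multiplies \<open>u\<close> by \<open>1 - t + t * r\<close>, and
  \<open>powr_neg_convex\<close> applies to that factor.\<close>

lemma bet_powr:
  assumes "K > 1" "0 < u" "u \<le> 1" "0 < r" "0 \<le> c"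
  shows "bet K u r powr (- c) \<le>
    u powr (- c) * (1 - min 1 ((1 / u - 1) / (K - 1)) * (1 - r powr (- c)))"
proof -
  define t where "t = min 1 ((1 / u - 1) / (K - 1))"
  have t: "0 \<le> t" "t \<le> 1" using assms by (auto simp: t_def)
  have "min u ((1 - u) / (K - 1)) = u * t"
  proof -
    have "u * ((1 / u - 1) / (K - 1)) = (1 - u) / (K - 1)"
      using assms by (simp add: right_diff_distrib)
    thus ?thesis using assms by (simp add: t_def min_mult_distrib_left)
  qed
  hence b: "bet K u r = u * (1 - t + t * r)" by (simp add: bet_def algebra_simps)
  have "bet K u r powr (- c) = u powr (- c) * (1 - t + t * r) powr (- c)"
    unfolding b using assms t by (intro powr_mult)
  also have "\<dots> \<le> u powr (- c) * (1 - t + t * r powr (- c))"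
    using powr_neg_convex[OF assms(4) t assms(5)] by (intro mult_left_mono) auto
  finally show ?thesis by (simp add: t_def algebra_simps)
qed

text \<open>Transition operator of the wealth process when outcomes follow \<open>p\<close>: its
  \<open>n\<close>-fold iterate on \<open>f\<close> at \<open>u\<close> is the expectation of
  \<open>f\<close> at the wealth after \<open>n\<close> independent bets started from
  \<open>u\<close>.\<close>

definition bet_step :: "real \<Rightarrow> ('a::finite \<Rightarrow> real) \<Rightarrow> ('a \<Rightarrow> real) \<Rightarrow> (real \<Rightarrow> real) \<Rightarrow> real \<Rightarrow> real" where
  "bet_step K p r f u = (\<Sum>a\<in>UNIV. p a * f (bet K u (r a)))"

text \<open>\<open>growth\<close> is the exponential-moment form of the bets being favourable under
  \<open>p\<close>. Positivity of \<open>r\<close> on the support keeps the wealth positive. The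
  normalizations \<open>K \<ge> 2\<close> and \<open>c \<le> 1\<close> give
  \<open>\<kappa> \<ge> 0\<close> and \<open>u powr (- c) \<le> 1 / u\<close>.\<close>

locale betting =
  fixes p r :: "'a::finite \<Rightarrow> real" and K c :: real
  assumes p: "is_distr p" and r: "\<And>a. p a > 0 \<Longrightarrow> 0 < r a \<and> r a \<le> K"
    and K: "K \<ge> 2" and c: "0 < c" "c \<le> 1"
    and growth: "(\<Sum>a\<in>UNIV. p a * r a powr (- c)) < 1"
begin

definition "\<mu> = (\<Sum>a\<in>UNIV. p a * r a powr (- c))"

abbreviation "T \<equiv> bet_step K p r"

lemma p_nonneg: "p a \<ge> 0" and p_sum: "(\<Sum>a\<in>UNIV. p a) = 1"
  using p by (auto simp: is_distr_def)

lemma \<mu>: "0 \<le> \<mu>" "\<mu> < 1"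
  using growth by (auto simp: \<mu>_def intro!: sum_nonneg mult_nonneg_nonneg p_nonneg)

lemma T_mono:
  assumes "\<And>v. 0 < v \<Longrightarrow> v \<le> 1 \<Longrightarrow> f v \<le> g v" "0 < u" "u \<le> 1"
  shows "T f u \<le> T g u"
  unfolding bet_step_def
proof (rule sum_mono)
  fix a
  show "p a * f (bet K u (r a)) \<le> p a * g (bet K u (r a))"
  proof (cases "p a > 0")
    case True
    with r[OF this] K assms show ?thesis
      by (intro mult_left_mono assms(1) bet_pos bet_le_1) auto
  next
    case False
    thus ?thesis using p_nonneg[of a] by simp
  qed
qed

lemma T_funpow_mono:
  assumes "\<And>v. 0 < v \<Longrightarrow> v \<le> 1 \<Longrightarrow> f v \<le> g v" "0 < u" "u \<le> 1"
  shows "(T ^^ n) f u \<le> (T ^^ n) g u"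
  using assms(2,3)
proof (induction n arbitrary: u)
  case (Suc n)
  then show ?case by (auto intro!: T_mono)
qed (use assms in auto)

lemma T_affine: "T (\<lambda>v. x * f v + y) = (\<lambda>v. x * T f v + y)"
proof
  fix u
  have "T (\<lambda>v. x * f v + y) u
      = (\<Sum>a\<in>UNIV. x * (p a * f (bet K u (r a))) + y * p a)"
    unfolding bet_step_def by (intro sum.cong refl) (simp add: algebra_simps)
  also have "\<dots> = x * T f u + y"
    by (simp only: bet_step_def sum.distrib flip: sum_distrib_left) (simp add: p_sum)
  finally show "T (\<lambda>v. x * f v + y) u = x * T f u + y" .
qed

lemma T_funpow_affine: "(T ^^ n) (\<lambda>v. x * f v + y) = (\<lambda>v. x * (T ^^ n) f v + y)"
  by (induction n) (simp_all add: T_affine)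

lemma T_powr:
  assumes "0 < u" "u \<le> 1"
  shows "T (\<lambda>v. v powr (- c)) u \<le>
    u powr (- c) * (1 - min 1 ((1 / u - 1) / (K - 1)) * (1 - \<mu>))"
proof -
  define t where "t = min 1 ((1 / u - 1) / (K - 1))"
  have "T (\<lambda>v. v powr (- c)) u \<le>
      (\<Sum>a\<in>UNIV. p a * (u powr (- c) * (1 - t * (1 - r a powr (- c)))))"
    unfolding bet_step_def
  proof (rule sum_mono)
    fix a
    show "p a * bet K u (r a) powr (- c) \<le> p a * (u powr (- c) * (1 - t * (1 - r a powr (- c))))"
    proof (cases "p a > 0")
      case True
      with r[OF this] K c assms show ?thesis
        unfolding t_def by (intro mult_left_mono bet_powr) auto
    next
      case False
      thus ?thesis using p_nonneg[of a] by simp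
    qed
  qed
  also have "\<dots> = (\<Sum>a\<in>UNIV. u powr (- c) * (1 - t) * p a + u powr (- c) * t * (p a * r a powr (- c)))"
    by (intro sum.cong refl) (simp add: algebra_simps)
  also have "\<dots> = u powr (- c) * (1 - t * (1 - \<mu>))"
    by (simp only: sum.distrib flip: sum_distrib_left) (simp add: p_sum \<mu>_def algebra_simps)
  finally show ?thesis by (simp add: t_def)
qed

text \<open>Far below the target the full wealth is staked and \<open>u powr (- c)\<close> shrinks at the rate \<open>\<mu>\<close>;
  otherwise \<open>u \<ge> 1 / K\<close>.\<close>

lemma T_powr_drift:
  assumes "0 < u" "u \<le> 1"
  shows "T (\<lambda>v. v powr (- c)) u \<le> \<mu> * u powr (- c) + (1 - \<mu>) * K powr c"
proof (cases "1 \<le> (1 / u - 1) / (K - 1)")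
  case True
  hence "T (\<lambda>v. v powr (- c)) u \<le> \<mu> * u powr (- c)"
    using T_powr[OF assms] by (simp add: min_def mult_ac)
  moreover have "0 \<le> (1 - \<mu>) * K powr c" using \<mu> by simp
  ultimately show ?thesis by linarith
next
  case False
  define t where "t = min 1 ((1 / u - 1) / (K - 1))"
  have "0 \<le> t" using assms K by (auto simp: t_def)
  have "1 / u \<le> K" using False K assms by (simp add: field_simps)
  hence "(1 / u) powr c \<le> K powr c" using assms c by (intro powr_mono2) auto
  hence W: "u powr (- c) \<le> K powr c" using assms by (simp add: powr_minus_divide powr_divide)
  have "T (\<lambda>v. v powr (- c)) u \<le> u powr (- c) * (1 - t * (1 - \<mu>))"
    using T_powr[OF assms] by (simp add: t_def)
  also have "\<dots> \<le> u powr (- c) * 1"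
    using \<open>0 \<le> t\<close> \<mu> by (intro mult_left_mono) auto
  also have "\<dots> = \<mu> * u powr (- c) + (1 - \<mu>) * u powr (- c)" by (simp add: algebra_simps)
  also have "\<dots> \<le> \<mu> * u powr (- c) + (1 - \<mu>) * K powr c"
    using W \<mu> by (intro add_left_mono mult_left_mono) auto
  finally show ?thesis .
qed

lemma T_funpow_powr:
  assumes "0 < u" "u \<le> 1"
  shows "(T ^^ n) (\<lambda>v. v powr (- c)) u \<le> \<mu> ^ n * u powr (- c) + K powr c"
proof -
  \<comment> \<open>This sharper form closes the induction: \<open>K powr c\<close> is the fixed
    point of the affine map in \<open>T_powr_drift\<close>.\<close>
  have "(T ^^ n) (\<lambda>v. v powr (- c)) u \<le> \<mu> ^ n * u powr (- c) + (1 - \<mu> ^ n) * K powr c"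
    using assms
  proof (induction n arbitrary: u)
    case (Suc n)
    have "(T ^^ Suc n) (\<lambda>v. v powr (- c)) u
        \<le> T (\<lambda>v. \<mu> ^ n * v powr (- c) + (1 - \<mu> ^ n) * K powr c) u"
      using Suc by (auto intro!: T_mono)
    also have "\<dots> = \<mu> ^ n * T (\<lambda>v. v powr (- c)) u + (1 - \<mu> ^ n) * K powr c"
      by (simp add: T_affine)
    also have "\<dots> \<le> \<mu> ^ n * (\<mu> * u powr (- c) + (1 - \<mu>) * K powr c) + (1 - \<mu> ^ n) * K powr c"
      using T_powr_drift[OF Suc.prems] \<mu> by (intro add_right_mono mult_left_mono) auto
    finally show ?case by (simp add: algebra_simps)
  qed auto
  also have "\<dots> \<le> \<mu> ^ n * u powr (- c) + 1 * K powr c"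
    using \<mu> by (intro add_left_mono mult_right_mono) auto
  finally show ?thesis by simp
qed

definition "\<kappa> = 1 - (1 - \<mu>) / (K - 1)"

lemma \<kappa>: "0 \<le> \<kappa>" "\<kappa> < 1"
proof -
  have "(1 - \<mu>) / (K - 1) \<le> 1" using K \<mu> by (simp add: field_simps)
  thus "0 \<le> \<kappa>" by (simp add: \<kappa>_def)
  show "\<kappa> < 1" using K \<mu> by (simp add: \<kappa>_def)
qed

text \<open>With \<open>w = u powr (- c)\<close> the expected decrease is at least
  \<open>t * w * (1 - \<mu>)\<close>. Under full stake \<open>t = 1\<close>; near the target
  \<open>t\<close> is proportional to \<open>1 / u - 1\<close>, which is at least
  \<open>w - 1\<close> since \<open>c \<le> 1\<close>. Either way the decrease is at least a fixed
  share of \<open>w - 1\<close>.\<close>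

lemma T_contract:
  assumes "0 < u" "u \<le> 1"
  shows "T (\<lambda>v. v powr (- c) - 1) u \<le> \<kappa> * (u powr (- c) - 1)"
proof -
  define t where "t = min 1 ((1 / u - 1) / (K - 1))"
  define w where "w = u powr (- c)"
  have "0 \<le> t" using assms K by (auto simp: t_def)
  have w1: "1 \<le> w" unfolding w_def using assms c
    by (metis less_eq_real_def neg_le_0_iff_le powr_mono' powr_one_eq_one powr_zero_eq_one zero_less_one not_le)
  have "u powr (- c) \<le> u powr (- 1)"
    using assms c by (intro powr_mono') auto
  hence w2: "w - 1 \<le> 1 / u - 1" using assms by (simp add: w_def powr_minus_divide)
  have key: "(w - 1) / (K - 1) \<le> t * w"
  proof (cases "1 \<le> (1 / u - 1) / (K - 1)")
    case True
    hence "t = 1" by (simp add: t_def)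
    moreover have "(w - 1) / (K - 1) \<le> (w - 1) / 1"
      using w1 K by (intro divide_left_mono) auto
    ultimately show ?thesis by simp
  next
    case False
    hence "t = (1 / u - 1) / (K - 1)" by (simp add: t_def)
    hence "(w - 1) / (K - 1) \<le> t * 1" using w2 K by (simp add: divide_right_mono)
    also have "\<dots> \<le> t * w" using w1 \<open>0 \<le> t\<close> by (intro mult_left_mono)
    finally show ?thesis .
  qed
  have "T (\<lambda>v. v powr (- c) - 1) u = T (\<lambda>v. v powr (- c)) u - 1"
    using T_affine[of 1 "\<lambda>v. v powr (- c)" "-1"] by simp
  also have "\<dots> \<le> w * (1 - t * (1 - \<mu>)) - 1"
    using T_powr[OF assms] by (simp add: t_def w_def)
  also have "\<dots> = w - 1 - (t * w) * (1 - \<mu>)" by (simp add: algebra_simps)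
  also have "\<dots> \<le> w - 1 - (w - 1) / (K - 1) * (1 - \<mu>)"
    using key \<mu> by (intro diff_left_mono mult_right_mono) auto
  also have "\<dots> = \<kappa> * (w - 1)" using K by (simp add: \<kappa>_def field_simps)
  finally show ?thesis by (simp add: w_def)
qed

lemma T_funpow_contract:
  assumes "0 < u" "u \<le> 1"
  shows "(T ^^ n) (\<lambda>v. v powr (- c) - 1) u \<le> \<kappa> ^ n * (u powr (- c) - 1)"
  using assms
proof (induction n arbitrary: u)
  case (Suc n)
  have "(T ^^ Suc n) (\<lambda>v. v powr (- c) - 1) u \<le> T (\<lambda>v. \<kappa> ^ n * (v powr (- c) - 1) + 0) u"
    using Suc by (auto intro!: T_mono)
  also have "\<dots> = \<kappa> ^ n * T (\<lambda>v. v powr (- c) - 1) u"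
    by (subst T_affine) simp
  also have "\<dots> \<le> \<kappa> ^ n * (\<kappa> * (u powr (- c) - 1))"
    using T_contract[OF Suc.prems] \<kappa> by (intro mult_left_mono) auto
  finally show ?case by (simp add: mult_ac)
qed auto

text \<open>Two phases: the first \<open>m\<close> bets bring the expected
  \<open>u powr (- c)\<close> down to order \<open>K powr c\<close>, the last \<open>k\<close>
  contract its excess over \<open>1\<close> by \<open>\<kappa>\<close> each. By \<open>lin\<close>,
  a small expected excess means an expected wealth near \<open>1\<close>.\<close>

lemma T_funpow_id_lower:
  assumes "0 < u" "u \<le> 1"
  shows "(T ^^ (m + k)) (\<lambda>v. v) u \<ge> 1 - \<kappa> ^ k * (\<mu> ^ m * u powr (- c) + K powr c) / c"
proof -
  have lin: "- (1 / c) * (v powr (- c) - 1) + 1 \<le> v" if "0 < v" "v \<le> 1" for v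
  proof -
    have "1 + (- c * ln v) \<le> exp (- c * ln v)" by (rule exp_ge_add_one_self)
    moreover have "- c * ln v \<ge> - c * (v - 1)"
      using c ln_le_minus_one[OF that(1)] by (simp add: mult_left_mono)
    ultimately have "c * (1 - v) \<le> v powr (- c) - 1"
      using that by (simp add: powr_def algebra_simps)
    thus ?thesis using c by (simp add: field_simps)
  qed
  have "(T ^^ (m + k)) (\<lambda>v. v powr (- c) - 1) u = (T ^^ m) ((T ^^ k) (\<lambda>v. v powr (- c) - 1)) u"
    by (simp add: funpow_add)
  also have "\<dots> \<le> (T ^^ m) (\<lambda>v. \<kappa> ^ k * v powr (- c) + 0) u"
  proof (rule T_funpow_mono[OF _ assms])
    fix v :: real assume v: "0 < v" "v \<le> 1"
    have "(T ^^ k) (\<lambda>v. v powr (- c) - 1) v \<le> \<kappa> ^ k * (v powr (- c) - 1)"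
      by (rule T_funpow_contract[OF v])
    also have "\<dots> \<le> \<kappa> ^ k * v powr (- c) + 0" using \<kappa> by (simp add: algebra_simps)
    finally show "(T ^^ k) (\<lambda>v. v powr (- c) - 1) v \<le> \<kappa> ^ k * v powr (- c) + 0" .
  qed
  also have "\<dots> = \<kappa> ^ k * (T ^^ m) (\<lambda>v. v powr (- c)) u"
    by (subst T_funpow_affine) simp
  also have "\<dots> \<le> \<kappa> ^ k * (\<mu> ^ m * u powr (- c) + K powr c)"
    using \<kappa> T_funpow_powr[OF assms] by (intro mult_left_mono) auto
  finally have *: "(T ^^ (m + k)) (\<lambda>v. v powr (- c) - 1) u \<le> \<kappa> ^ k * (\<mu> ^ m * u powr (- c) + K powr c)" .
  have "1 - \<kappa> ^ k * (\<mu> ^ m * u powr (- c) + K powr c) / c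
      \<le> - (1 / c) * (T ^^ (m + k)) (\<lambda>v. v powr (- c) - 1) u + 1"
    using * c by (simp add: divide_right_mono)
  also have "\<dots> = (T ^^ (m + k)) (\<lambda>v. - (1 / c) * (v powr (- c) - 1) + 1) u"
    by (simp only: T_funpow_affine)
  also have "\<dots> \<le> (T ^^ (m + k)) (\<lambda>v. v) u"
    using lin by (intro T_funpow_mono[OF _ assms])
  finally show ?thesis .
qed

lemma T_funpow_id_le_1:
  assumes "0 < u" "u \<le> 1"
  shows "(T ^^ n) (\<lambda>v. v) u \<le> 1"
proof -
  have "(T ^^ n) (\<lambda>v. v) u \<le> (T ^^ n) (\<lambda>v. 0 * v + 1) u"
    using assms by (intro T_funpow_mono) auto
  thus ?thesis by (subst (asm) T_funpow_affine) simp
qed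

text \<open>The starting wealth may vanish exponentially, at a rate limited by
  \<open>\<mu> * b < 1\<close>. The number \<open>k\<close> of final bets is fixed first from
  \<open>e\<close>; all others go to the recovery phase, where
  \<open>\<mu> ^ m * b ^ n = (\<mu> * b) ^ m * b ^ k\<close>.\<close>

lemma T_funpow_id_tendsto:
  assumes u: "\<And>n. 0 < u n" "\<And>n. u n \<le> 1"
    and b: "\<And>n. u n powr (- c) \<le> b ^ n" "0 < b" "\<mu> * b < 1"
  shows "(\<lambda>n. (T ^^ n) (\<lambda>v. v) (u n)) \<longlonglongrightarrow> 1"
proof (rule LIMSEQ_I)
  fix e :: real assume e: "e > 0"
  have "(\<lambda>k. \<kappa> ^ k * (1 + K powr c) / c) \<longlonglongrightarrow> 0 * (1 + K powr c) / c"
    using \<kappa> c by (intro tendsto_intros LIMSEQ_power_zero) auto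
  hence "eventually (\<lambda>k. \<kappa> ^ k * (1 + K powr c) / c < e) sequentially"
    using e by (intro order_tendstoD(2)[where y = 0]) auto
  then obtain k where k: "\<kappa> ^ k * (1 + K powr c) / c < e"
    by (auto simp: eventually_sequentially)
  have "(\<lambda>m. (\<mu> * b) ^ m * b ^ k) \<longlonglongrightarrow> 0 * b ^ k"
    using \<mu> b by (intro tendsto_intros LIMSEQ_power_zero) auto
  hence "eventually (\<lambda>m. (\<mu> * b) ^ m * b ^ k < 1) sequentially"
    by (intro order_tendstoD(2)[where y = 0]) auto
  then obtain m0 where m0: "\<And>m. m \<ge> m0 \<Longrightarrow> (\<mu> * b) ^ m * b ^ k < 1"
    by (auto simp: eventually_sequentially)
  have "norm ((T ^^ n) (\<lambda>v. v) (u n) - 1) < e" if n: "n \<ge> m0 + k" for n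
  proof -
    define m where "m = n - k"
    have nm: "n = m + k" "m \<ge> m0" using n by (auto simp: m_def)
    have "\<mu> ^ m * u n powr (- c) \<le> \<mu> ^ m * b ^ n"
      using \<mu> b(1) by (intro mult_left_mono) auto
    also have "\<dots> = (\<mu> * b) ^ m * b ^ k" by (simp add: nm power_add power_mult_distrib)
    also have "\<dots> \<le> 1" using m0 nm by (simp add: less_imp_le)
    finally have "\<kappa> ^ k * (\<mu> ^ m * u n powr (- c) + K powr c) / c \<le> \<kappa> ^ k * (1 + K powr c) / c"
      using \<kappa> c by (intro divide_right_mono mult_left_mono) auto
    hence "\<kappa> ^ k * (\<mu> ^ m * u n powr (- c) + K powr c) / c < e" using k by linarith
    moreover have "(T ^^ n) (\<lambda>v. v) (u n) \<ge> 1 - \<kappa> ^ k * (\<mu> ^ m * u n powr (- c) + K powr c) / c"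
      unfolding nm by (rule T_funpow_id_lower[OF u[of "m+k"]])
    moreover have "(T ^^ n) (\<lambda>v. v) (u n) \<le> 1" by (rule T_funpow_id_le_1[OF u])
    ultimately show ?thesis by simp
  qed
  thus "\<exists>no. \<forall>n\<ge>no. norm ((T ^^ n) (\<lambda>v. v) (u n) - 1) < e" by blast
qed

end

section \<open>Codes from betting strategies\<close>

lemma seqs_0 [simp]: "seqs 0 = {[]}"
  by (auto simp: seqs_def)

lemma Cons_in_seqs [simp]: "x # xs \<in> seqs (Suc n) \<longleftrightarrow> xs \<in> seqs n"
  by (simp add: seqs_def)

lemma seqs_SucE:
  assumes "zs \<in> seqs (Suc n)"
  obtains z zs' where "zs = z # zs'" "zs' \<in> seqs n"
  using assms by (cases zs) (auto simp: seqs_def)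

lemma sum_seqs_Suc:
  fixes f :: "'a::finite list \<Rightarrow> 'b::comm_monoid_add"
  shows "(\<Sum>zs\<in>seqs (Suc n). f zs) = (\<Sum>z\<in>UNIV. \<Sum>zs\<in>seqs n. f (z # zs))"
proof -
  have "(\<Sum>zs\<in>seqs (Suc n). f zs) = (\<Sum>(z, zs)\<in>UNIV \<times> seqs n. f (z # zs))"
    by (rule sum.reindex_bij_witness[where i = "\<lambda>(z, zs). z # zs" and j = "\<lambda>zs. (hd zs, tl zs)"])
       (auto elim!: seqs_SucE)
  thus ?thesis by (simp add: sum.cartesian_product)
qed

lemma sum_UNIV_triple:
  fixes f :: "'a::finite \<times> 'b::finite \<times> 'c::finite \<Rightarrow> 'd::comm_monoid_add"
  shows "sum f UNIV = (\<Sum>a\<in>UNIV. \<Sum>b\<in>UNIV. \<Sum>c\<in>UNIV. f (a, b, c))"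
  by (simp add: sum.cartesian_product flip: UNIV_Times_UNIV)

lemma PSn_Nil [simp]: "PSn P [] = 1"
  by (simp add: PSn_def)

lemma PSn_Cons [simp]: "PSn P (s # ss) = P s * PSn P ss"
  by (simp add: PSn_def prod.lessThan_Suc_shift del: prod.lessThan_Suc)

lemma Nn_Nil [simp]: "Nn N [] ss ys = 1"
  by (simp add: Nn_def)

lemma Nn_Cons [simp]: "Nn N (x # xs) (s # ss) (y # ys) = N x s y * Nn N xs ss ys"
  by (simp add: Nn_def prod.lessThan_Suc_shift del: prod.lessThan_Suc)

lemma PSn_nonneg: "(\<And>s. P s \<ge> 0) \<Longrightarrow> PSn P ss \<ge> 0"
  by (simp add: PSn_def prod_nonneg)

lemma Nn_nonneg: "(\<And>x s y. N x s y \<ge> 0) \<Longrightarrow> Nn N xs ss ys \<ge> 0"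
  by (simp add: Nn_def prod_nonneg)

lemma sum_PSn: "(\<Sum>s\<in>UNIV. P s) = 1 \<Longrightarrow> (\<Sum>ss\<in>seqs n. PSn P (ss :: 's::finite list)) = 1"
  by (induction n) (simp_all add: sum_seqs_Suc flip: sum_distrib_left sum_distrib_right)

lemma sum_Nn:
  assumes "is_channel N" "xs \<in> seqs n" "ss \<in> seqs n"
  shows "(\<Sum>ys\<in>seqs n. Nn N xs ss ys) = 1"
  using assms(2,3)
proof (induction n arbitrary: xs ss)
  case (Suc n)
  from Suc.prems show ?case using assms(1)
    by (auto elim!: seqs_SucE simp: sum_seqs_Suc Suc.IH is_channel_def is_distr_def
        simp flip: sum_distrib_left sum_distrib_right)
qed simp

fun input_prob :: "('s \<Rightarrow> 'x \<Rightarrow> real) \<Rightarrow> 'x list \<Rightarrow> 's list \<Rightarrow> real" where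
  "input_prob Q (x # xs) (s # ss) = Q s x * input_prob Q xs ss"
| "input_prob Q _ _ = 1"

text \<open>Reading the lists from the front makes the wealth after \<open>i\<close> uses a function
  of the first \<open>i\<close> letters only, as causality demands. The current wealth is an
  argument so that inductions can vary it.\<close>

fun wealth :: "real \<Rightarrow> ('x \<Rightarrow> 's \<Rightarrow> 'y \<Rightarrow> real) \<Rightarrow> real \<Rightarrow> 'x list \<Rightarrow> 's list \<Rightarrow> 'y list \<Rightarrow> real" where
  "wealth K r u (x # xs) (s # ss) (y # ys) = wealth K r (bet K u (r x s y)) xs ss ys"
| "wealth K r u _ _ _ = u"

text \<open>\<open>r_mean\<close> is the fairness of the bets: for each state and output the payoff
  ratio averages to \<open>1\<close> over inputs drawn from \<open>Q\<close>. The bounds on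
  \<open>r\<close> keep the wealth in the unit interval.\<close>

locale betting_code =
  fixes Q :: "'s::finite \<Rightarrow> 'x::finite \<Rightarrow> real"
    and r :: "'x \<Rightarrow> 's \<Rightarrow> 'y::finite \<Rightarrow> real" and K :: real
  assumes Q: "\<And>s. is_distr (Q s)" and K: "K > 1" and r: "\<And>x s y. 0 \<le> r x s y"
    and r_le: "\<And>x s y. r x s y \<le> K"
    and r_mean: "\<And>s y. (\<Sum>x\<in>UNIV. Q s x * r x s y) = 1"
begin

lemma Q_nonneg: "Q s x \<ge> 0" and Q_sum: "(\<Sum>x\<in>UNIV. Q s x) = 1"
  using Q by (auto simp: is_distr_def)

lemma input_prob_nonneg: "input_prob Q xs ss \<ge> 0"
proof (induction xs arbitrary: ss)
  case (Cons x xs)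
  then show ?case by (cases ss) (auto simp: Q_nonneg)
qed simp



lemma wealth_bounds:
  assumes "0 \<le> u" "u \<le> 1"
  shows "0 \<le> wealth K r u xs ss ys \<and> wealth K r u xs ss ys \<le> 1"
  using assms
proof (induction xs arbitrary: u ss ys)
  case (Cons x xs)
  then show ?case using K r r_le
    by (cases ss; cases ys) (auto simp: bet_nonneg bet_le_1)
qed auto

lemma joint_bounds:
  assumes "0 \<le> u" "u \<le> 1"
  shows "0 \<le> input_prob Q xs ss * wealth K r u xs ss ys"
    and "input_prob Q xs ss * wealth K r u xs ss ys \<le> input_prob Q xs ss"
  using wealth_bounds[OF assms] input_prob_nonneg[of xs ss] by (simp_all add: mult_left_le)

lemma sum_input_prob:
  "ss \<in> seqs n \<Longrightarrow> (\<Sum>xs\<in>seqs n. input_prob Q xs ss) = 1"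
  by (induction n arbitrary: ss)
     (auto elim!: seqs_SucE simp: sum_seqs_Suc Q_sum simp flip: sum_distrib_left sum_distrib_right)

text \<open>With states and outputs fixed, fairness makes the wealth a martingale under
  \<open>Q\<close>.\<close>

lemma sum_joint:
  assumes "ss \<in> seqs n" "ys \<in> seqs n"
  shows "(\<Sum>xs\<in>seqs n. input_prob Q xs ss * wealth K r u xs ss ys) = u"
  using assms
proof (induction n arbitrary: u ss ys)
  case (Suc n)
  obtain s ss' y ys' where [simp]: "ss = s # ss'" "ys = y # ys'"
    and *: "ss' \<in> seqs n" "ys' \<in> seqs n"
    using Suc.prems by (auto elim!: seqs_SucE)
  define m where "m = min u ((1 - u) / (K - 1))"
  have "(\<Sum>xs\<in>seqs (Suc n). input_prob Q xs ss * wealth K r u xs ss ys)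
      = (\<Sum>x\<in>UNIV. Q s x * bet K u (r x s y))"
    by (simp add: sum_seqs_Suc mult.assoc Suc.IH[OF *] flip: sum_distrib_left)
  also have "\<dots> = (\<Sum>x\<in>UNIV. (u - m) * Q s x + m * (Q s x * r x s y))"
    by (intro sum.cong refl) (simp add: bet_def m_def algebra_simps)
  also have "\<dots> = u"
    by (simp only: sum.distrib flip: sum_distrib_left) (simp add: Q_sum r_mean)
  finally show ?case .
qed simp

lemma sum_input_prob_append:
  assumes "xp \<in> seqs i" "i \<le> n" "ss \<in> seqs n"
  shows "(\<Sum>xr\<in>seqs (n - i). input_prob Q (xp @ xr) ss) = input_prob Q xp (take i ss)"
  using assms
proof (induction i arbitrary: xp ss n)
  case 0
  then show ?case by (simp add: sum_input_prob)
next
  case (Suc i)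
  then obtain m where [simp]: "n = Suc m" by (cases n) auto
  from Suc.prems show ?case
    by (auto elim!: seqs_SucE simp: Suc.IH simp flip: sum_distrib_left)
qed

text \<open>The bets placed after use \<open>i\<close> are fair, so averaging over the remaining
  inputs leaves the wealth at time \<open>i\<close>.\<close>

lemma sum_joint_append:
  assumes "xp \<in> seqs i" "i \<le> n" "ss \<in> seqs n" "ys \<in> seqs n"
  shows "(\<Sum>xr\<in>seqs (n - i). input_prob Q (xp @ xr) ss * wealth K r u (xp @ xr) ss ys)
    = input_prob Q xp (take i ss) * wealth K r u xp (take i ss) (take i ys)"
  using assms
proof (induction i arbitrary: u xp ss ys n)
  case 0
  then show ?case by (simp add: sum_joint)
next
  case (Suc i)
  then obtain m where [simp]: "n = Suc m" by (cases n) auto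
  from Suc.prems show ?case
    by (auto elim!: seqs_SucE simp: Suc.IH mult.assoc simp flip: sum_distrib_left)
qed

lemma wealth_one [simp]: "wealth K r 1 xs ss ys = 1"
proof (induction xs arbitrary: ss ys)
  case (Cons x xs)
  then show ?case using K by (cases ss; cases ys) auto
qed simp

text \<open>For \<open>M = 1\<close> the division by \<open>0\<close> is never reached, as then \<open>w' = w\<close>.\<close>

definition code :: "nat \<Rightarrow> 'x list \<Rightarrow> nat \<Rightarrow> nat \<Rightarrow> 's list \<Rightarrow> 'y list \<Rightarrow> real" where
  "code M xs w' w ss ys =
     (let d = input_prob Q xs ss * wealth K r (1 / real M) xs ss ys
      in if w' = w then d else (input_prob Q xs ss - d) / (real M - 1))"

text \<open>Yields (C1): the correct message receives \<open>d\<close> and the \<open>M - 1\<close>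
  wrong ones share the rest, leaving no trace of the output.\<close>

lemma sum_code_message:
  assumes "w \<in> {1..M}"
  shows "(\<Sum>w'\<in>{1..M}. code M xs w' w ss ys) = input_prob Q xs ss"
proof -
  define d where "d = input_prob Q xs ss * wealth K r (1 / real M) xs ss ys"
  have "(\<Sum>w'\<in>{1..M}. code M xs w' w ss ys)
      = (\<Sum>w'\<in>{1..M} - {w}. (input_prob Q xs ss - d) / (real M - 1)) + d"
    using assms by (simp add: sum.remove[of _ w] code_def d_def)
  also have "\<dots> = input_prob Q xs ss"
  proof (cases "M = 1")
    \<comment> \<open>There are no wrong messages, and the wealth starts and stays at
      \<open>1\<close>, so \<open>d\<close> is already the whole input probability.\<close>
    case True
    thus ?thesis by (simp add: d_def)
  next
    case False
    with assms have "M > 1" by auto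
    thus ?thesis using assms by (simp add: of_nat_diff)
  qed
  finally show ?thesis .
qed

text \<open>Yields (C3): \<open>input_prob\<close> and its product with \<open>wealth\<close> both
  collapse to their prefix values, so states after position \<open>i\<close> disappear.\<close>

lemma sum_code_append:
  assumes "xp \<in> seqs i" "i \<le> n" "ss \<in> seqs n" "ys \<in> seqs n"
  shows "(\<Sum>xr\<in>seqs (n - i). code M (xp @ xr) w' w ss ys) =
    code M xp w' w (take i ss) (take i ys)"
proof (cases "w' = w")
  case True
  thus ?thesis by (simp add: code_def sum_joint_append[OF assms])
next
  case False
  thus ?thesis
    by (simp add: code_def sum_joint_append[OF assms] sum_input_prob_append[OF assms(1-3)]
        sum_subtractf flip: sum_divide_distrib)
qed

text \<open>Yields (C2): the starting wealth \<open>1 / M\<close> is the probability of the correct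
  message, and the remaining \<open>1 - 1 / M\<close> splits into \<open>M - 1\<close> shares of the
  same size.\<close>

lemma sum_code_input:
  assumes "w \<in> {1..M}" "w' \<in> {1..M}" "ss \<in> seqs n" "ys \<in> seqs n"
  shows "(\<Sum>xs\<in>seqs n. code M xs w' w ss ys) = 1 / real M"
proof -
  have "(1 - 1 / real M) / (real M - 1) = 1 / real M" if "w \<noteq> w'"
    using assms that by (auto simp: field_simps)
  thus ?thesis
    using sum_code_append[of "[]" 0 n ss ys M w' w] assms(3,4) by (auto simp: code_def Let_def)
qed

lemma code_nonneg:
  assumes "M \<ge> 1"
  shows "code M xs w' w ss ys \<ge> 0"
  using joint_bounds[of "1 / real M" xs ss ys] assms by (auto simp: code_def Let_def)

lemma NS_causal_code_code:
  assumes "M \<ge> 1"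
  shows "NS_causal_code M n (code M)"
  unfolding NS_causal_code_def
proof (intro conjI ballI impI)
  fix i w w' :: nat and ss ss' :: "'s list" and ys :: "'y list" and xp :: "'x list"
  assume "i \<in> {1..n-1}" "ss \<in> seqs n" "ss' \<in> seqs n" "ys \<in> seqs n" "xp \<in> seqs i"
    "take i ss = take i ss'"
  moreover from this have "i \<le> n" by auto
  ultimately show "(\<Sum>xr\<in>seqs (n - i). code M (xp @ xr) w' w ss ys) =
      (\<Sum>xr\<in>seqs (n - i). code M (xp @ xr) w' w ss' ys)"
    by (simp add: sum_code_append)
qed (simp_all add: code_nonneg assms sum_code_message sum_input_prob sum_code_input
    del: One_nat_def)

text \<open>Each message contributes equally, and under the channel law the triples of state, input
  and output are independent with distribution \<open>p\<close>, so success has the probability of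
  the expected final wealth.\<close>

lemma success_prob_code:
  fixes N :: "'x \<Rightarrow> 's \<Rightarrow> 'y \<Rightarrow> real" and P :: "'s \<Rightarrow> real"
  assumes "M \<ge> 1"
  defines "p \<equiv> \<lambda>(s, x, y). P s * Q s x * N x s y"
  shows "success_prob N P M n (code M) =
    (bet_step K p (\<lambda>(s, x, y). r x s y) ^^ n) (\<lambda>u. u) (1 / real M)"
proof -
  have E: "(\<Sum>xs\<in>seqs n. \<Sum>ss\<in>seqs n. \<Sum>ys\<in>seqs n.
        PSn P ss * Nn N xs ss ys * (input_prob Q xs ss * wealth K r u xs ss ys))
      = (bet_step K p (\<lambda>(s, x, y). r x s y) ^^ n) (\<lambda>u. u) u" (is "?E n u = _") for u
  proof (induction n arbitrary: u)
    case (Suc n)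
    have "?E (Suc n) u = (\<Sum>x\<in>UNIV. \<Sum>xs\<in>seqs n. \<Sum>s\<in>UNIV. \<Sum>ss\<in>seqs n. \<Sum>y\<in>UNIV. \<Sum>ys\<in>seqs n.
        P s * Q s x * N x s y * (PSn P ss * Nn N xs ss ys *
          (input_prob Q xs ss * wealth K r (bet K u (r x s y)) xs ss ys)))"
      by (simp add: sum_seqs_Suc mult_ac)
    also have "\<dots> = (\<Sum>x\<in>UNIV. \<Sum>s\<in>UNIV. \<Sum>xs\<in>seqs n. \<Sum>y\<in>UNIV. \<Sum>ss\<in>seqs n. \<Sum>ys\<in>seqs n.
        P s * Q s x * N x s y * (PSn P ss * Nn N xs ss ys *
          (input_prob Q xs ss * wealth K r (bet K u (r x s y)) xs ss ys)))"
      by (intro sum.cong refl, subst sum.swap, intro sum.cong refl, rule sum.swap)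
    also have "\<dots> = (\<Sum>s\<in>UNIV. \<Sum>x\<in>UNIV. \<Sum>y\<in>UNIV.
        P s * Q s x * N x s y * ?E n (bet K u (r x s y)))"
      unfolding sum_distrib_left
      by (subst sum.swap) (intro sum.cong refl, rule sum.swap)
    also have "\<dots> = (bet_step K p (\<lambda>(s, x, y). r x s y) ^^ Suc n) (\<lambda>u. u) u"
      by (simp add: bet_step_def sum_UNIV_triple) (simp add: Suc.IH p_def)
    finally show ?case .
  qed simp
  have "success_prob N P M n (code M) = (1 / real M) * (\<Sum>w\<in>{1..M}. \<Sum>xs\<in>seqs n.
      \<Sum>ss\<in>seqs n. \<Sum>ys\<in>seqs n. PSn P ss * Nn N xs ss ys *
        (input_prob Q xs ss * wealth K r (1 / real M) xs ss ys))"
    by (simp add: success_prob_def code_def)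
  also have "\<dots> = (bet_step K p (\<lambda>(s, x, y). r x s y) ^^ n) (\<lambda>u. u) (1 / real M)"
    using assms(1) by (simp add: E)
  finally show ?thesis .
qed

end

section \<open>Achievability\<close>

definition output_prob :: "('x::finite \<Rightarrow> 'y \<Rightarrow> real) \<Rightarrow> ('x \<Rightarrow> real) \<Rightarrow> 'y \<Rightarrow> real" where
  "output_prob W P y = (\<Sum>x\<in>UNIV. P x * W x y)"

text \<open>In nats. Where \<open>q y = 0 < p y\<close> the quotient is \<open>0\<close> in HOL and
  the divergence not infinite, so absolute continuity is assumed or proved separately.\<close>

definition divergence :: "('y::finite \<Rightarrow> real) \<Rightarrow> ('y \<Rightarrow> real) \<Rightarrow> real" where
  "divergence p q = (\<Sum>y\<in>UNIV. p y * ln (p y / q y))"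

definition mutual_info :: "('x::finite \<Rightarrow> 'y::finite \<Rightarrow> real) \<Rightarrow> ('x \<Rightarrow> real) \<Rightarrow> real" where
  "mutual_info W P = (\<Sum>x\<in>UNIV. P x * divergence (W x) (output_prob W P))"

lemma is_distr_nonneg: "is_distr P \<Longrightarrow> 0 \<le> P a"
  and is_distr_sum: "is_distr P \<Longrightarrow> sum P UNIV = 1"
  by (auto simp: is_distr_def)

lemma is_distr_le_1:
  assumes "is_distr P"
  shows "P a \<le> 1"
  using member_le_sum[of a UNIV P] assms by (auto simp: is_distr_def)

lemma is_distr_output_prob:
  assumes "\<And>x. is_distr (W x)" "is_distr P"
  shows "is_distr (output_prob W P)"
proof -
  have "(\<Sum>y\<in>UNIV. output_prob W P y) = (\<Sum>x\<in>UNIV. P x * (\<Sum>y\<in>UNIV. W x y))"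
    unfolding output_prob_def by (subst sum.swap) (simp add: sum_distrib_left)
  thus ?thesis using assms
    by (auto simp: is_distr_def output_prob_def intro!: sum_nonneg mult_nonneg_nonneg)
qed

lemma output_prob_pos:
  assumes "\<And>x. is_distr (W x)" "is_distr P" "P x > 0" "W x y > 0"
  shows "output_prob W P y > 0"
  unfolding output_prob_def
  by (rule sum_pos2[of _ x]) (use assms in \<open>auto simp: is_distr_def\<close>)

text \<open>Where the joint probability is nonzero, \<open>P s\<close> and \<open>Q s x\<close>
  cancel inside the logarithm; the other terms vanish on both sides. Dividing by \<open>ln 2\<close>
  turns nats into bits.\<close>

lemma cond_mutual_info_eq:
  assumes N: "is_channel N" and P: "is_distr P" and Q: "\<And>s. is_distr (Q s)"
  shows "cond_mutual_info N P Q = (\<Sum>s\<in>UNIV. P s * mutual_info (\<lambda>x. N x s) (Q s)) / ln 2"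
proof -
  have N': "is_distr (N x s)" for x s using N by (simp add: is_channel_def)
  have sums: "(\<Sum>y\<in>UNIV. P s * Q s x * N x s y) = P s * Q s x"
    "(\<Sum>x\<in>UNIV. P s * Q s x * N x s y) = P s * output_prob (\<lambda>x. N x s) (Q s) y" for s x y
    by (simp add: is_distr_sum[OF N'] flip: sum_distrib_left)
       (simp add: output_prob_def sum_distrib_left mult.assoc)
  have "cond_mutual_info N P Q = (\<Sum>s\<in>UNIV. \<Sum>x\<in>UNIV. \<Sum>y\<in>UNIV.
      P s * Q s x * N x s y * ln (N x s y / output_prob (\<lambda>x. N x s) (Q s) y) / ln 2)"
    unfolding cond_mutual_info_def Let_def sums
    by (intro sum.cong refl) (auto simp: log_def)
  thus ?thesis
    by (simp add: mutual_info_def divergence_def sum_distrib_left sum_divide_distrib mult.assoc)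
qed

text \<open>Ensures that the supremum is over a nonempty set even if all mutual informations vanish.
  A single message and payoff ratio \<open>1\<close> keep the wealth at \<open>1\<close>, which is
  certain success.\<close>

lemma achievable_NS_causal_0:
  fixes N :: "'x::finite \<Rightarrow> 's::finite \<Rightarrow> 'y::finite \<Rightarrow> real"
  assumes N: "is_channel N" and P: "is_distr P"
  shows "achievable_NS_causal N P 0"
proof -
  define Q where "Q = (\<lambda>(s::'s) (x::'x). if x = undefined then 1 else 0 :: real)"
  define p where "p = (\<lambda>(s, x, y). P s * Q s x * N x s y)"
  have Q: "is_distr (Q s)" for s by (simp add: is_distr_def Q_def)
  have N': "is_distr (N x s)" for x s using N by (simp add: is_channel_def)
  interpret betting_code Q "\<lambda>(x::'x) (s::'s) (y::'y). 1" 2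
    using Q by unfold_locales (auto simp: is_distr_sum)
  have "sum p UNIV = 1"
    by (simp add: sum_UNIV_triple p_def is_distr_sum[OF N'] is_distr_sum[OF P] is_distr_sum[OF Q]
        flip: sum_distrib_left)
  hence "(bet_step 2 p (\<lambda>_. 1) ^^ n) (\<lambda>u. u) 1 = 1" for n
    by (induction n) (simp_all add: bet_step_def)
  hence "success_prob N P 1 n (code 1) = 1" for n
    using success_prob_code[of 1 N P n] by (simp add: p_def split_def)
  thus ?thesis using NS_causal_code_code[of 1]
    unfolding achievable_NS_causal_def
    by (intro conjI exI[of _ "\<lambda>_. 1"] exI[of _ "\<lambda>_. code 1"] exI[of _ 0]) auto
qed

text \<open>At rate \<open>R\<close> the initial wealth is about \<open>2 powr (- R * n)\<close>, so
  \<open>\<mu> * b < 1\<close> is needed for \<open>b = 2 powr (R * c)\<close>. This product, as a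
  function \<open>\<phi>\<close> of the exponent, equals \<open>1\<close> at \<open>0\<close> and
  has derivative \<open>R * ln 2 - I < 0\<close> there, so a small \<open>c\<close> works.\<close>

lemma achievable_below_cond_mutual_info:
  fixes N :: "'x::finite \<Rightarrow> 's::finite \<Rightarrow> 'y::finite \<Rightarrow> real"
  assumes N: "is_channel N" and P: "is_distr P" and Q: "\<And>s. is_distr (Q s)"
    and R: "0 \<le> R" "R < cond_mutual_info N P Q"
  shows "achievable_NS_causal N P R"
proof -
  define q where "q s = output_prob (\<lambda>x. N x s) (Q s)" for s
  \<comment> \<open>The default \<open>1\<close> keeps the mean payoff ratio at \<open>1\<close> for
    outputs of probability zero.\<close>
  define r where "r x s y = (if q s y > 0 then N x s y / q s y else 1)" for x s y
  define p where "p = (\<lambda>(s, x, y). P s * Q s x * N x s y)"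
  define r' where "r' = (\<lambda>(s, x, y). r x s y)"
  define K where "K = 2 + (\<Sum>a\<in>UNIV. r' a)"
  have N': "is_distr (N x s)" for x s using N by (simp add: is_channel_def)
  have q: "is_distr (q s)" for s unfolding q_def by (intro is_distr_output_prob N' Q)
  have r_nonneg: "0 \<le> r x s y" for x s y
    by (auto simp: r_def is_distr_nonneg[OF N'] is_distr_nonneg[OF q])
  have K2: "K \<ge> 2" using r_nonneg by (auto simp: K_def r'_def intro!: sum_nonneg)
  have r'_le: "r' a \<le> K" for a
    using member_le_sum[of a UNIV r'] r_nonneg by (auto simp: K_def r'_def)
  have r_mean: "(\<Sum>x\<in>UNIV. Q s x * r x s y) = 1" for s y
  proof (cases "q s y > 0")
    case True
    have "(\<Sum>x\<in>UNIV. Q s x * r x s y) = (\<Sum>x\<in>UNIV. Q s x * N x s y) / q s y"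
      using True by (simp add: r_def sum_divide_distrib)
    thus ?thesis using True by (simp add: q_def output_prob_def)
  next
    case False
    thus ?thesis by (simp add: r_def is_distr_sum[OF Q])
  qed
  interpret betting_code Q r K
    using K2 r_nonneg r'_le r_mean Q by unfold_locales (auto simp: r'_def)
  have p_pos: "P s > 0" "Q s x > 0" "N x s y > 0" if "p (s, x, y) > 0" for s x y
    using that is_distr_nonneg[OF P, of s] is_distr_nonneg[OF Q, of s x]
      is_distr_nonneg[OF N', of x s y]
    by (auto simp: p_def zero_less_mult_iff)
  have q_pos: "q s y > 0" if "p (s, x, y) > 0" for s x y
    unfolding q_def using p_pos[OF that] by (intro output_prob_pos[of _ _ x] N' Q)
  have p_nonneg: "p a \<ge> 0" for a
    by (auto simp: p_def split_def is_distr_nonneg[OF P] is_distr_nonneg[OF Q] is_distr_nonneg[OF N'])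
  have p: "is_distr p"
    unfolding is_distr_def sum_UNIV_triple
    by (auto simp: p_nonneg)
       (simp add: p_def is_distr_sum[OF N'] is_distr_sum[OF P] is_distr_sum[OF Q]
         flip: sum_distrib_left)
  have r'_pos: "r' a > 0" if "p a > 0" for a
    using p_pos[of "fst a" "fst (snd a)" "snd (snd a)"] q_pos[of "fst a" "fst (snd a)" "snd (snd a)"] that
    by (auto simp: r'_def r_def split_def)
  define I where "I = (\<Sum>a\<in>UNIV. p a * ln (r' a))"
  have "I = (\<Sum>s\<in>UNIV. P s * mutual_info (\<lambda>x. N x s) (Q s))"
  proof -
    have "I = (\<Sum>s\<in>UNIV. \<Sum>x\<in>UNIV. \<Sum>y\<in>UNIV. P s * Q s x * N x s y * ln (N x s y / q s y))"
      unfolding I_def sum_UNIV_triple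
    proof (intro sum.cong refl)
      fix s x y
      show "p (s, x, y) * ln (r' (s, x, y)) = P s * Q s x * N x s y * ln (N x s y / q s y)"
      proof (cases "p (s, x, y) = 0")
        case True
        thus ?thesis unfolding p_def by auto
      next
        case False
        hence "q s y > 0" using q_pos[of s x y] p_nonneg[of "(s, x, y)"] by simp
        thus ?thesis by (simp add: p_def r'_def r_def)
      qed
    qed
    thus ?thesis
      by (simp add: mutual_info_def divergence_def sum_distrib_left mult.assoc q_def)
  qed
  hence I: "R * ln 2 < I"
    using R(2) by (simp add: cond_mutual_info_eq[OF N P Q] field_simps)

  define \<phi> where "\<phi> h = (\<Sum>a\<in>UNIV. p a * exp (- h * (ln (r' a) - R * ln 2)))" for h
  have "(\<phi> has_real_derivative (\<Sum>a\<in>UNIV. p a * - (ln (r' a) - R * ln 2))) (at 0)"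
    unfolding \<phi>_def by (auto intro!: derivative_eq_intros sum.cong)
  moreover have "(\<Sum>a\<in>UNIV. p a * - (ln (r' a) - R * ln 2)) = R * ln 2 - I"
    by (simp add: I_def right_diff_distrib sum_subtractf is_distr_sum[OF p]
        flip: sum_distrib_right)
  ultimately obtain d where d: "d > 0" "\<And>h. 0 < h \<Longrightarrow> h < d \<Longrightarrow> \<phi> h < \<phi> 0"
    using DERIV_neg_dec_right[of \<phi> "R * ln 2 - I" 0] I by auto
  define c where "c = min 1 (d / 2)"
  have c: "0 < c" "c \<le> 1" "c < d" using d(1) by (auto simp: c_def)
  define b where "b = 2 powr (R * c)"
  have b: "b \<ge> 1" using R c by (simp add: b_def ge_one_powr_ge_zero)
  have "\<phi> c = (\<Sum>a\<in>UNIV. p a * r' a powr (- c)) * b"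
    unfolding \<phi>_def sum_distrib_right
  proof (intro sum.cong refl)
    fix a
    show "p a * exp (- c * (ln (r' a) - R * ln 2)) = p a * r' a powr (- c) * b"
      using r'_pos[of a] p_nonneg[of a]
      by (cases "p a = 0") (auto simp: powr_def b_def algebra_simps simp flip: exp_add)
  qed
  moreover have "\<phi> 0 = 1" by (simp add: \<phi>_def is_distr_sum[OF p])
  ultimately have rate: "(\<Sum>a\<in>UNIV. p a * r' a powr (- c)) * b < 1"
    using d(2)[of c] c by simp
  have "(\<Sum>a\<in>UNIV. p a * r' a powr (- c)) * 1 \<le> (\<Sum>a\<in>UNIV. p a * r' a powr (- c)) * b"
    using b by (intro mult_left_mono sum_nonneg mult_nonneg_nonneg p_nonneg) auto
  with rate have "(\<Sum>a\<in>UNIV. p a * r' a powr (- c)) < 1" by linarith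
  then interpret betting p r' K c
    using p r'_pos r'_le K2 c by unfold_locales auto

  \<comment> \<open>Rounding down costs at most a factor of \<open>2\<close>, hence at most
    \<open>1 / n\<close> in rate.\<close>
  define M where "M n = nat \<lfloor>2 powr (R * real n)\<rfloor>" for n
  have ge1: "1 \<le> 2 powr (R * real n)" for n using R by (simp add: ge_one_powr_ge_zero)
  have M1: "M n \<ge> 1" for n using ge1[of n] unfolding M_def by linarith
  have M_le: "real (M n) \<le> 2 powr (R * real n)" for n using ge1[of n] unfolding M_def by linarith
  have "2 powr (R * real n) < real (M n) + 1" for n using ge1[of n] unfolding M_def by linarith
  hence M_ge: "2 powr (R * real n) / 2 \<le> real (M n)" for n using M1[of n] by (smt (verit) field_sum_of_halves of_nat_1 of_nat_mono)
  have "(\<lambda>n. (bet_step K p r' ^^ n) (\<lambda>u. u) (1 / real (M n))) \<longlonglongrightarrow> 1"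
  proof (rule T_funpow_id_tendsto)
    fix n
    show "0 < 1 / real (M n)" "1 / real (M n) \<le> 1" using M1[of n] by auto
    have "(1 / real (M n)) powr (- c) = real (M n) powr c"
      using M1[of n] by (simp add: powr_divide powr_minus_divide)
    also have "\<dots> \<le> (2 powr (R * real n)) powr c" using M_le c by (intro powr_mono2) auto
    also have "\<dots> = b ^ n" by (simp add: b_def powr_powr powr_realpow[symmetric] mult_ac)
    finally show "(1 / real (M n)) powr (- c) \<le> b ^ n" .
  qed (use b rate in \<open>auto simp: \<mu>_def\<close>)
  hence succ: "(\<lambda>n. success_prob N P (M n) n (code (M n))) \<longlonglongrightarrow> 1"
    by (simp add: success_prob_code[OF M1] p_def r'_def)
  have "(\<lambda>n. log 2 (real (M n)) / real n) \<longlonglongrightarrow> R"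
  proof (rule tendsto_sandwich[of "\<lambda>n. R - 1 / real n" _ _ "\<lambda>n. R"])
    have "(\<lambda>n. R - 1 / real n) \<longlonglongrightarrow> R - 0" by (intro tendsto_intros lim_1_over_n)
    thus "(\<lambda>n. R - 1 / real n) \<longlonglongrightarrow> R" by simp
    show "eventually (\<lambda>n. R - 1 / real n \<le> log 2 (real (M n)) / real n) sequentially"
      using eventually_gt_at_top[of 0]
    proof eventually_elim
      case (elim n)
      have "R * real n - 1 = log 2 (2 powr (R * real n) / 2)" by (simp add: log_divide)
      also have "\<dots> \<le> log 2 (real (M n))" using M_ge[of n] M1[of n] by (subst log_le_cancel_iff) auto
      finally have "(R * real n - 1) / real n \<le> log 2 (real (M n)) / real n"
        by (rule divide_right_mono) simp
      thus ?case using elim by (simp add: diff_divide_distrib)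
    qed
    show "eventually (\<lambda>n. log 2 (real (M n)) / real n \<le> R) sequentially"
      using eventually_gt_at_top[of 0]
    proof eventually_elim
      case (elim n)
      have "log 2 (real (M n)) \<le> log 2 (2 powr (R * real n))"
        using M_le[of n] M1[of n] by (subst log_le_cancel_iff) auto
      thus ?case using elim by (simp add: field_simps)
    qed
  qed simp
  with succ M1 NS_causal_code_code[OF M1] R(1) show ?thesis
    unfolding achievable_NS_causal_def
    by (intro conjI exI[of _ M] exI[of _ "\<lambda>n. code (M n)"] exI[of _ R]) auto
qed

section \<open>Capacity-achieving input distributions\<close>

text \<open>The endpoint matters: \<open>0 * ln 0 = 0\<close> agrees with the limit, so entropies
  are continuous up to the boundary of the simplex.\<close>

lemma continuous_on_x_ln_x: "continuous_on {0..} (\<lambda>x::real. x * ln x)"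
proof -
  have "((\<lambda>x::real. x * ln x) \<longlongrightarrow> 0) (at_right 0)" by real_asymp
  moreover have "at 0 within {0..} = at_right (0::real)"
    by (simp add: at_within_Ici_at_right)
  ultimately have "continuous (at x within {0..}) (\<lambda>x::real. x * ln x)" if "x \<ge> 0" for x
    using that
    by (cases "x = 0") (auto simp: continuous_within intro!: tendsto_intros)
  thus ?thesis by (simp add: continuous_on_eq_continuous_within)
qed

text \<open>Separating the logarithms gives a formula that is continuous on the whole simplex, also
  where output probabilities vanish.\<close>

lemma mutual_info_eq_entropies:
  assumes "\<And>x. is_distr (W x)" "is_distr P"
  shows "mutual_info W P = (\<Sum>x\<in>UNIV. P x * (\<Sum>y\<in>UNIV. W x y * ln (W x y)))
    - (\<Sum>y\<in>UNIV. output_prob W P y * ln (output_prob W P y))"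
proof -
  have "mutual_info W P = (\<Sum>x\<in>UNIV. \<Sum>y\<in>UNIV. P x * (W x y * ln (W x y))
      - P x * W x y * ln (output_prob W P y))"
    unfolding mutual_info_def divergence_def sum_distrib_left
  proof (intro sum.cong refl)
    fix x y
    have "P x * W x y = 0 \<or> P x > 0 \<and> W x y > 0"
      using is_distr_nonneg[OF assms(1), of x y] is_distr_nonneg[OF assms(2), of x] by auto
    thus "P x * (W x y * ln (W x y / output_prob W P y)) =
        P x * (W x y * ln (W x y)) - P x * W x y * ln (output_prob W P y)"
      using output_prob_pos[of W P x y, OF assms] by (auto simp: ln_div algebra_simps)
  qed
  also have "\<dots> = (\<Sum>x\<in>UNIV. \<Sum>y\<in>UNIV. P x * (W x y * ln (W x y)))
      - (\<Sum>y\<in>UNIV. \<Sum>x\<in>UNIV. P x * W x y * ln (output_prob W P y))"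
    by (simp add: sum_subtractf) (rule sum.swap)
  finally show ?thesis
    by (simp add: output_prob_def sum_distrib_left sum_distrib_right)
qed

lemma exists_mutual_info_maximizer:
  fixes W :: "'x::finite \<Rightarrow> 'y::finite \<Rightarrow> real"
  assumes W: "\<And>x. is_distr (W x)"
  shows "\<exists>P. is_distr P \<and> (\<forall>P'. is_distr P' \<longrightarrow> mutual_info W P' \<le> mutual_info W P)"
proof -
  \<comment> \<open>The simplex as a set of vectors, where closed and bounded means compact.\<close>
  define S where "S = {v :: real ^ 'x. is_distr (\<lambda>x. v $ x)}"
  define F where "F v = (\<Sum>x\<in>UNIV. v $ x * (\<Sum>y\<in>UNIV. W x y * ln (W x y)))
    - (\<Sum>y\<in>UNIV. output_prob W (\<lambda>x. v $ x) y * ln (output_prob W (\<lambda>x. v $ x) y))" for v :: "real ^ 'x"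
  have S_eq: "S = (\<Inter>x. {v. 0 \<le> v $ x}) \<inter> {v. (\<Sum>x\<in>UNIV. v $ x) = 1}"
    by (auto simp: S_def is_distr_def)
  have "closed S" unfolding S_eq
    by (intro closed_Int closed_INT ballI closed_Collect_le closed_Collect_eq continuous_intros)
  moreover have "bounded S"
  proof (rule boundedI)
    fix v assume "v \<in> S"
    hence "(\<Sum>x\<in>UNIV. \<bar>v $ x\<bar>) = 1" by (simp add: S_def is_distr_def)
    thus "norm v \<le> 1" using norm_le_l1_cart[of v] by simp
  qed
  ultimately have "compact S" by (simp add: compact_eq_bounded_closed)
  moreover have "(\<chi> x. if x = undefined then 1 else 0) \<in> S"
    by (simp add: S_def is_distr_def)
  hence "S \<noteq> {}" by auto
  moreover have "continuous_on S F"
  proof -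
    have "continuous_on S (\<lambda>v. output_prob W (\<lambda>x. v $ x) y * ln (output_prob W (\<lambda>x. v $ x) y))" for y
    proof (rule continuous_on_compose2[OF continuous_on_x_ln_x])
      show "continuous_on S (\<lambda>v. output_prob W (\<lambda>x. v $ x) y)"
        unfolding output_prob_def by (intro continuous_intros)
      show "(\<lambda>v. output_prob W (\<lambda>x. v $ x) y) ` S \<subseteq> {0..}"
        using is_distr_output_prob[of W, OF W] by (auto simp: S_def is_distr_nonneg)
    qed
    thus ?thesis unfolding F_def
      by (intro continuous_on_diff continuous_on_sum) (auto intro!: continuous_intros)
  qed
  ultimately have "\<exists>v\<in>S. \<forall>v'\<in>S. F v' \<le> F v" by (rule continuous_attains_sup)
  then obtain v where v: "v \<in> S" "\<And>v'. v' \<in> S \<Longrightarrow> F v' \<le> F v" by blast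
  have "mutual_info W P' \<le> mutual_info W (\<lambda>x. v $ x)" if P': "is_distr P'" for P'
  proof -
    have "(\<chi> x. P' x) \<in> S" using P' by (simp add: S_def vec_lambda_inverse)
    from v(2)[OF this] v(1) P' show ?thesis
      by (simp add: mutual_info_eq_entropies[OF W] F_def S_def vec_lambda_inverse)
  qed
  thus ?thesis using v(1) by (auto simp: S_def)
qed

section \<open>Divergence inequalities and optimality conditions\<close>

lemma divergence_nonneg:
  assumes "is_distr p" "is_distr q" "\<And>y. p y > 0 \<Longrightarrow> q y > 0"
  shows "divergence p q \<ge> 0"
proof -
  have "p y - q y \<le> p y * ln (p y / q y)" for y
  proof (cases "p y > 0")
    case True
    hence "q y > 0" using assms by simp
    hence "ln (q y / p y) \<le> q y / p y - 1" using True by (intro ln_le_minus_one) auto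
    hence "p y * ln (q y / p y) \<le> p y * (q y / p y - 1)" using True by (intro mult_left_mono) auto
    thus ?thesis using True \<open>q y > 0\<close> by (simp add: ln_div algebra_simps)
  next
    case False
    thus ?thesis using is_distr_nonneg[OF assms(1), of y] is_distr_nonneg[OF assms(2), of y] by simp
  qed
  hence "(\<Sum>y\<in>UNIV. p y - q y) \<le> divergence p q"
    unfolding divergence_def by (rule sum_mono)
  thus ?thesis by (simp add: sum_subtractf is_distr_sum assms)
qed

text \<open>Compensation identity: replacing the true output law by \<open>q\<close> raises the mean
  divergence by exactly \<open>divergence (output_prob W P) q\<close>, which is nonnegative.\<close>

lemma mean_divergence_ge_mutual_info:
  assumes W: "\<And>x. is_distr (W x)" and P: "is_distr P" and q: "is_distr q"
    and ac: "\<And>y. output_prob W P y > 0 \<Longrightarrow> q y > 0"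
  shows "mutual_info W P \<le> (\<Sum>x\<in>UNIV. P x * divergence (W x) q)"
proof -
  have "(\<Sum>x\<in>UNIV. P x * divergence (W x) q) - mutual_info W P
      = (\<Sum>x\<in>UNIV. \<Sum>y\<in>UNIV. P x * W x y * ln (output_prob W P y / q y))"
    unfolding mutual_info_def divergence_def sum_distrib_left sum_subtractf[symmetric]
  proof (intro sum.cong refl)
    fix x y
    have "P x * W x y = 0 \<or> P x > 0 \<and> W x y > 0"
      using is_distr_nonneg[OF W, of x y] is_distr_nonneg[OF P, of x] by auto
    thus "P x * (W x y * ln (W x y / q y)) - P x * (W x y * ln (W x y / output_prob W P y)) =
        P x * W x y * ln (output_prob W P y / q y)"
      using output_prob_pos[of W P x y, OF W P] ac[of y] by (auto simp: ln_div algebra_simps)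
  qed
  also have "\<dots> = divergence (output_prob W P) q"
    by (subst sum.swap) (simp add: divergence_def output_prob_def sum_distrib_right)
  also have "\<dots> \<ge> 0"
    by (intro divergence_nonneg is_distr_output_prob W P q ac)
  finally show ?thesis by simp
qed

text \<open>Moving mass \<open>t\<close> from the maximizer to a single input \<open>x\<close> cannot increase the mutual
  information, which bounds the divergence from the perturbed output distribution;
  then \<open>t\<close> tends to \<open>0\<close>.\<close>

lemma mutual_info_maximizer_KKT:
  fixes W :: "'x::finite \<Rightarrow> 'y::finite \<Rightarrow> real"
  assumes W: "\<And>x. is_distr (W x)" and P: "is_distr P"
    and max: "\<And>P'. is_distr P' \<Longrightarrow> mutual_info W P' \<le> mutual_info W P"
  shows "W x y > 0 \<Longrightarrow> output_prob W P y > 0"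
    and "divergence (W x) (output_prob W P) \<le> mutual_info W P"
proof -
  define C where "C = mutual_info W P"
  define q where "q = output_prob W P"
  define qt where "qt t y = (1 - t) * q y + t * W x y" for t y
  have q: "is_distr q" unfolding q_def by (intro is_distr_output_prob W P)
  have qt: "is_distr (qt t)" if "0 < t" "t < 1" for t
    using that q W[of x] by (auto simp: is_distr_def qt_def sum.distrib simp flip: sum_distrib_left)
  have bound: "divergence (W x) (qt t) \<le> C" if t: "0 < t" "t < 1" for t
  proof -
    define P' where "P' x' = (1 - t) * P x' + t * (if x' = x then 1 else 0)" for x'
    have P': "is_distr P'"
      using t P by (auto simp: is_distr_def P'_def sum.distrib simp flip: sum_distrib_left)
    have out: "output_prob W P' = qt t"
      by (rule ext)
         (simp add: output_prob_def P'_def qt_def q_def sum_distrib_left algebra_simps sum.distrib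
           sum_subtractf if_distrib[of "\<lambda>z. _ * z"] cong: if_cong)
    have "mutual_info W P' = (\<Sum>x'\<in>UNIV. (1 - t) * (P x' * divergence (W x') (qt t))
        + (if x' = x then t * divergence (W x) (qt t) else 0))"
      unfolding mutual_info_def out by (intro sum.cong refl) (auto simp: P'_def algebra_simps)
    also have "\<dots> = (1 - t) * (\<Sum>x'\<in>UNIV. P x' * divergence (W x') (qt t)) + t * divergence (W x) (qt t)"
      by (simp add: sum.distrib sum_distrib_left)
    finally have "(1 - t) * (\<Sum>x'\<in>UNIV. P x' * divergence (W x') (qt t)) + t * divergence (W x) (qt t) \<le> C"
      using max[OF P'] by (simp add: C_def)
    \<comment> \<open>The old inputs already account for \<open>(1 - t) * C\<close>, so the input
      \<open>x\<close> can add at most \<open>t * C\<close>.\<close>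
    moreover have "(1 - t) * C \<le> (1 - t) * (\<Sum>x'\<in>UNIV. P x' * divergence (W x') (qt t))"
      unfolding C_def
    proof (intro mult_left_mono mean_divergence_ge_mutual_info W P qt t)
      fix y assume "output_prob W P y > 0"
      thus "qt t y > 0" using t is_distr_nonneg[OF W, of x y]
        by (auto simp: qt_def q_def intro!: add_pos_nonneg)
    qed (use t in auto)
    ultimately have "t * divergence (W x) (qt t) \<le> t * C" by (simp add: algebra_simps)
    thus ?thesis using t by simp
  qed

  \<comment> \<open>If the maximizer missed an output reachable from \<open>x\<close>, that output
    would contribute \<open>W x y * ln (1 / t)\<close> to the divergence, breaking
    \<open>bound\<close> for small \<open>t\<close>.\<close>
  have ac: "q y > 0" if Wy: "W x y > 0" for y
  proof (rule ccontr)
    assume "\<not> q y > 0"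
    hence qy: "q y = 0" using is_distr_nonneg[OF q, of y] by simp
    define B where "B = (\<Sum>y'\<in>UNIV - {y}. W x y' * ln (W x y'))"
    \<comment> \<open>Chosen so that the term of \<open>y\<close> is exactly
      \<open>\<bar>C\<bar> + \<bar>B\<bar> + 1\<close>; the other terms sum to at least
      \<open>B\<close> because \<open>qt t\<close> never exceeds \<open>1\<close>.\<close>
    define t where "t = exp (- ((\<bar>C\<bar> + \<bar>B\<bar> + 1) / W x y))"
    have t: "0 < t" "t < 1" using Wy by (auto simp: t_def)
    have "B \<le> (\<Sum>y'\<in>UNIV - {y}. W x y' * ln (W x y' / qt t y'))"
      unfolding B_def
    proof (rule sum_mono)
      fix y'
      show "W x y' * ln (W x y') \<le> W x y' * ln (W x y' / qt t y')"
      proof (cases "W x y' > 0")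
        case True
        hence "0 < qt t y'" using t is_distr_nonneg[OF q, of y'] by (auto simp: qt_def intro!: add_nonneg_pos)
        moreover have "qt t y' \<le> 1" by (rule is_distr_le_1[OF qt[OF t]])
        ultimately have "W x y' \<le> W x y' / qt t y'" using True by (simp add: le_divide_eq_1 pos_le_divide_eq mult_left_le)
        thus ?thesis using True \<open>0 < qt t y'\<close> by (intro mult_left_mono) auto
      next
        case False
        thus ?thesis using is_distr_nonneg[OF W, of x y'] by simp
      qed
    qed
    moreover have "W x y * ln (W x y / qt t y) = \<bar>C\<bar> + \<bar>B\<bar> + 1"
      using Wy t(1) by (simp add: qt_def qy ln_div) (simp add: t_def)
    ultimately have "B + (\<bar>C\<bar> + \<bar>B\<bar> + 1) \<le> divergence (W x) (qt t)"
      by (simp add: divergence_def sum.remove[of UNIV y])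
    with bound[OF t] show False by linarith
  qed
  thus "W x y > 0 \<Longrightarrow> output_prob W P y > 0" by (simp add: q_def)

  have "((\<lambda>t. divergence (W x) (qt t)) \<longlongrightarrow> divergence (W x) q) (at_right 0)"
    unfolding divergence_def
  proof (rule tendsto_sum)
    fix y
    show "((\<lambda>t. W x y * ln (W x y / qt t y)) \<longlongrightarrow> W x y * ln (W x y / q y)) (at_right 0)"
    proof (cases "W x y > 0")
      case True
      have "((\<lambda>t. qt t y) \<longlongrightarrow> (1 - 0) * q y + 0 * W x y) (at_right 0)"
        unfolding qt_def by (intro tendsto_intros)
      thus ?thesis using ac[OF True] True by (intro tendsto_intros) auto
    next
      case False
      thus ?thesis using is_distr_nonneg[OF W, of x y] by simp
    qed
  qed
  moreover have "eventually (\<lambda>t. divergence (W x) (qt t) \<le> C) (at_right 0)"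
    unfolding eventually_at_right_field using bound by (intro exI[of _ 1]) auto
  ultimately have "divergence (W x) q \<le> C"
    by (intro tendsto_upperbound) auto
  thus "divergence (W x) (output_prob W P) \<le> mutual_info W P" by (simp add: q_def C_def)
qed

section \<open>Converse\<close>

lemma sum_PSn_additive:
  fixes P :: "'s::finite \<Rightarrow> real"
  assumes "is_distr P"
  shows "(\<Sum>ss\<in>seqs n. PSn P ss * (\<Sum>s\<leftarrow>ss. C s)) = real n * (\<Sum>s\<in>UNIV. P s * C s)"
proof (induction n)
  case (Suc n)
  have "(\<Sum>ss\<in>seqs (Suc n). PSn P ss * (\<Sum>s\<leftarrow>ss. C s))
      = (\<Sum>s\<in>UNIV. \<Sum>ss\<in>seqs n. P s * C s * PSn P ss + P s * (PSn P ss * (\<Sum>s\<leftarrow>ss. C s)))"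
    by (simp add: sum_seqs_Suc algebra_simps)
  also have "\<dots> = (\<Sum>s\<in>UNIV. P s * C s) + real n * (\<Sum>s\<in>UNIV. P s * C s)"
    by (simp add: sum.distrib Suc.IH sum_PSn is_distr_sum[OF assms]
        flip: sum_distrib_left sum_distrib_right)
  finally show ?case by (simp add: algebra_simps)
qed simp

fun output_prob_seq :: "('s \<Rightarrow> 'y \<Rightarrow> real) \<Rightarrow> 's list \<Rightarrow> 'y list \<Rightarrow> real" where
  "output_prob_seq q (s # ss) (y # ys) = q s y * output_prob_seq q ss ys"
| "output_prob_seq q _ _ = 1"

text \<open>Weighting the two values \<open>c = M\<close> and \<open>c = 1\<close> of the tangent bound
  \<open>a * ln (a / b) \<ge> a * ln c + a - c * b\<close> by the success and failure parts \<open>d\<close> and \<open>p - d\<close>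
  replaces the data-processing inequality for hypothesis tests.\<close>

lemma tangent_bound:
  fixes a b M d p :: real
  assumes "0 \<le> a" "0 \<le> b" "a > 0 \<Longrightarrow> b > 0" "M \<ge> 1" "0 \<le> d" "d \<le> p"
  shows "ln M * (d * a) + p * a - p * b - M * (d * b) \<le> p * (a * ln (a / b))"
proof -
  have tangent: "a * ln c + a - c * b \<le> a * ln (a / b)" if "c > 0" for c
  proof (cases "a > 0")
    case True
    hence "b > 0" using assms by simp
    hence "ln (c * b / a) \<le> c * b / a - 1" using True that by (intro ln_le_minus_one) auto
    hence "a * ln (c * b / a) \<le> a * (c * b / a - 1)" using True by (intro mult_left_mono) auto
    thus ?thesis using True \<open>b > 0\<close> that by (simp add: ln_div ln_mult algebra_simps)
  next
    case False
    thus ?thesis using assms that by simp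
  qed
  have "d * (a * ln M + a - M * b) + (p - d) * (a * ln 1 + a - 1 * b)
      \<le> d * (a * ln (a / b)) + (p - d) * (a * ln (a / b))"
    using tangent[of M] tangent[of 1] assms by (intro add_mono mult_left_mono) auto
  moreover have "0 \<le> d * b" using assms by simp
  ultimately show ?thesis by (simp add: algebra_simps)
qed

lemma NS_causal_codeD:
  assumes Z: "NS_causal_code M n Z"
    and w: "w \<in> {1..M}" and ss: "ss \<in> seqs n" and ys: "ys \<in> seqs n"
  shows NS_causal_code_nonneg: "xs \<in> seqs n \<Longrightarrow> w' \<in> {1..M} \<Longrightarrow> 0 \<le> Z xs w' w ss ys"
    and NS_causal_code_sum: "(\<Sum>xs\<in>seqs n. \<Sum>w'\<in>{1..M}. Z xs w' w ss ys) = 1"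
    and NS_causal_code_C1: "ys' \<in> seqs n \<Longrightarrow> xs \<in> seqs n \<Longrightarrow>
      (\<Sum>w'\<in>{1..M}. Z xs w' w ss ys) = (\<Sum>w'\<in>{1..M}. Z xs w' w ss ys')"
    and NS_causal_code_C2: "v \<in> {1..M} \<Longrightarrow> ss' \<in> seqs n \<Longrightarrow> w' \<in> {1..M} \<Longrightarrow>
      (\<Sum>xs\<in>seqs n. Z xs w' w ss ys) = (\<Sum>xs\<in>seqs n. Z xs w' v ss' ys)"
proof -
  note code = Z[unfolded NS_causal_code_def]
  note distr = code[THEN conjunct1, THEN bspec, THEN bspec, THEN bspec, OF w ss ys]
  show "xs \<in> seqs n \<Longrightarrow> w' \<in> {1..M} \<Longrightarrow> 0 \<le> Z xs w' w ss ys"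
    by (rule distr[THEN conjunct1, THEN bspec, THEN bspec])
  show "(\<Sum>xs\<in>seqs n. \<Sum>w'\<in>{1..M}. Z xs w' w ss ys) = 1"
    by (rule distr[THEN conjunct2])
  show "ys' \<in> seqs n \<Longrightarrow> xs \<in> seqs n \<Longrightarrow>
      (\<Sum>w'\<in>{1..M}. Z xs w' w ss ys) = (\<Sum>w'\<in>{1..M}. Z xs w' w ss ys')"
    by (rule code[THEN conjunct2, THEN conjunct1, THEN bspec, THEN bspec, THEN bspec,
        THEN bspec, THEN bspec, OF w ss ys])
  assume "v \<in> {1..M}" "ss' \<in> seqs n" "w' \<in> {1..M}"
  thus "(\<Sum>xs\<in>seqs n. Z xs w' w ss ys) = (\<Sum>xs\<in>seqs n. Z xs w' v ss' ys)"
    by (intro code[THEN conjunct2, THEN conjunct2, THEN conjunct1, THEN bspec, THEN bspec,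
        THEN bspec, THEN bspec, THEN bspec, THEN bspec] w ss ys)
qed

text \<open>\<open>div\<close> bounds every single input and not just an average, so it survives any
  dependence of inputs on states along a sequence. The optimality conditions supply it with
  \<open>C s\<close> the maximal mutual information in state \<open>s\<close>.\<close>

locale reference_output =
  fixes N :: "'x::finite \<Rightarrow> 's::finite \<Rightarrow> 'y::finite \<Rightarrow> real" and q :: "'s \<Rightarrow> 'y \<Rightarrow> real"
    and C :: "'s \<Rightarrow> real"
  assumes N: "is_channel N" and q: "\<And>s. is_distr (q s)"
    and ac: "\<And>x s y. N x s y > 0 \<Longrightarrow> q s y > 0"
    and div: "\<And>x s. divergence (N x s) (q s) \<le> C s"
begin

lemma N': "is_distr (N x s)"
  using N by (simp add: is_channel_def)

lemma output_prob_seq_nonneg: "output_prob_seq q ss ys \<ge> 0"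
proof (induction ss arbitrary: ys)
  case (Cons s ss)
  then show ?case by (cases ys) (auto simp: is_distr_nonneg[OF q])
qed simp

lemma sum_output_prob_seq: "ss \<in> seqs n \<Longrightarrow> (\<Sum>ys\<in>seqs n. output_prob_seq q ss ys) = 1"
  by (induction n arbitrary: ss)
     (auto elim!: seqs_SucE simp: sum_seqs_Suc is_distr_sum[OF q]
        simp flip: sum_distrib_left sum_distrib_right)

lemma output_prob_seq_pos:
  fixes ys :: "'y list"
  assumes "xs \<in> seqs n" "ss \<in> seqs n" "ys \<in> seqs n" "Nn N xs ss ys > 0"
  shows "output_prob_seq q ss ys > 0"
  using assms
proof (induction n arbitrary: xs ss ys)
  case (Suc n)
  obtain x xs' s ss' y ys' where [simp]: "xs = x # xs'" "ss = s # ss'" "ys = y # ys'"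
    and *: "xs' \<in> seqs n" "ss' \<in> seqs n" "ys' \<in> seqs n"
    using Suc.prems by (auto elim!: seqs_SucE)
  have "N x s y > 0" "Nn N xs' ss' ys' > 0"
    using Suc.prems(4) is_distr_nonneg[OF N', of x s y] Nn_nonneg[of N xs' ss' ys'] is_distr_nonneg[OF N']
    by (auto simp: zero_less_mult_iff)
  with Suc.IH[OF *] show ?case by (simp add: ac)
qed simp

text \<open>Chain rule for product laws: the logarithm splits over positions, and each contributes
  at most its \<open>C s\<close>.\<close>

lemma divergence_seq_le:
  assumes "xs \<in> seqs n" "ss \<in> seqs n"
  shows "(\<Sum>ys\<in>seqs n. Nn N xs ss ys * ln (Nn N xs ss ys / output_prob_seq q ss ys))
    \<le> (\<Sum>s\<leftarrow>ss. C s)"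
  using assms
proof (induction n arbitrary: xs ss)
  case (Suc n)
  obtain x xs' s ss' where [simp]: "xs = x # xs'" "ss = s # ss'"
    and *: "xs' \<in> seqs n" "ss' \<in> seqs n"
    using Suc.prems by (auto elim!: seqs_SucE)
  let ?d = "\<lambda>ys :: 'y list. Nn N xs' ss' ys * ln (Nn N xs' ss' ys / output_prob_seq q ss' ys)"
  have "(\<Sum>ys\<in>seqs (Suc n). Nn N xs ss ys * ln (Nn N xs ss ys / output_prob_seq q ss ys))
      = (\<Sum>y\<in>UNIV. \<Sum>ys\<in>seqs n. N x s y * ln (N x s y / q s y) * Nn N xs' ss' ys + N x s y * ?d ys)"
    unfolding sum_seqs_Suc
  proof (intro sum.cong refl)
    fix y and ys :: "'y list" assume ys: "ys \<in> seqs n"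
    have nn: "N x s y \<ge> 0" "Nn N xs' ss' ys \<ge> 0" by (auto intro!: Nn_nonneg is_distr_nonneg[OF N'])
    show "Nn N xs ss (y # ys) * ln (Nn N xs ss (y # ys) / output_prob_seq q ss (y # ys))
        = N x s y * ln (N x s y / q s y) * Nn N xs' ss' ys + N x s y * ?d ys"
    proof (cases "N x s y = 0 \<or> Nn N xs' ss' ys = 0")
      case True
      thus ?thesis by auto
    next
      case False
      hence "N x s y > 0" "Nn N xs' ss' ys > 0" using nn by auto
      moreover from this have "q s y > 0" "output_prob_seq q ss' ys > 0"
        using ac output_prob_seq_pos * ys by blast+
      ultimately show ?thesis by (simp add: ln_div ln_mult algebra_simps)
    qed
  qed
  also have "\<dots> = divergence (N x s) (q s) + sum ?d (seqs n)"
    by (simp add: sum.distrib sum_Nn[OF N *] divergence_def is_distr_sum[OF N']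
        flip: sum_distrib_left sum_distrib_right)
  also have "\<dots> \<le> C s + (\<Sum>s\<leftarrow>ss'. C s)"
    using div Suc.IH[OF *] by (intro add_mono)
  finally show ?case by simp
qed simp

text \<open>As a test, \<open>d\<close> accepts with probability \<open>\<eta> ss\<close> under the
  channel but exactly \<open>1 / M\<close> under any output law that ignores the input. Summing
  \<open>tangent_bound\<close> turns this gap into a lower bound on the divergence, and
  \<open>divergence_seq_le\<close> bounds it above.\<close>

lemma success_prob_converse:
  fixes Z :: "'x list \<Rightarrow> nat \<Rightarrow> nat \<Rightarrow> 's list \<Rightarrow> 'y list \<Rightarrow> real"
  assumes P: "is_distr P" and M: "M \<ge> 1" and Z: "NS_causal_code M n Z"
  shows "success_prob N P M n Z * ln (real M) \<le> real n * (\<Sum>s\<in>UNIV. P s * C s) + 1"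
proof -
  define ys0 :: "'y list" where "ys0 = replicate n undefined"
  define ss0 :: "'s list" where "ss0 = replicate n undefined"
  have ys0: "ys0 \<in> seqs n" and ss0: "ss0 \<in> seqs n" by (simp_all add: ys0_def ss0_def seqs_def)
  define d where "d xs ss ys = (\<Sum>w\<in>{1..M}. Z xs w w ss ys) / real M" for xs ss ys
  \<comment> \<open>The input law of the code; (C1) allows evaluating it at the arbitrary output
    \<open>ys0\<close>.\<close>
  define p where "p xs ss = (\<Sum>w\<in>{1..M}. \<Sum>w'\<in>{1..M}. Z xs w' w ss ys0) / real M" for xs ss
  let ?A = "\<lambda>xs ss ys. Nn N xs ss ys" and ?B = "output_prob_seq q"
  have d_nonneg: "0 \<le> d xs ss ys" if "xs \<in> seqs n" "ss \<in> seqs n" "ys \<in> seqs n" for xs ss ys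
    unfolding d_def using that by (intro divide_nonneg_nonneg sum_nonneg NS_causal_code_nonneg[OF Z]) auto
  have d_le: "d xs ss ys \<le> p xs ss" if "xs \<in> seqs n" "ss \<in> seqs n" "ys \<in> seqs n" for xs ss ys
    unfolding d_def p_def
  proof (intro divide_right_mono sum_mono)
    fix w assume w: "w \<in> {1..M}"
    have "Z xs w w ss ys \<le> (\<Sum>w'\<in>{1..M}. Z xs w' w ss ys)"
      using w that by (intro member_le_sum NS_causal_code_nonneg[OF Z]) auto
    thus "Z xs w w ss ys \<le> (\<Sum>w'\<in>{1..M}. Z xs w' w ss ys0)" using NS_causal_code_C1[OF Z w that(2,3) ys0 that(1)] by simp
  qed simp
  have p_sum: "(\<Sum>xs\<in>seqs n. p xs ss) = 1" if "ss \<in> seqs n" for ss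
  proof -
    have "(\<Sum>xs\<in>seqs n. p xs ss)
        = (\<Sum>w\<in>{1..M}. \<Sum>xs\<in>seqs n. \<Sum>w'\<in>{1..M}. Z xs w' w ss ys0) / real M"
      unfolding p_def sum_divide_distrib[symmetric] by (subst sum.swap) simp
    also have "(\<Sum>w\<in>{1..M}. \<Sum>xs\<in>seqs n. \<Sum>w'\<in>{1..M}. Z xs w' w ss ys0) = (\<Sum>w\<in>{1..M}. 1)"
      by (intro sum.cong refl NS_causal_code_sum[OF Z] that ys0)
    finally show ?thesis using M by simp
  qed
  \<comment> \<open>(C2) moves every term to message \<open>1\<close> and states \<open>ss0\<close>,
    where summing over decoded messages gives total mass \<open>1\<close>.\<close>
  have d_sum: "(\<Sum>xs\<in>seqs n. d xs ss ys) = 1 / real M" if "ss \<in> seqs n" "ys \<in> seqs n" for ss ys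
  proof -
    have "(\<Sum>xs\<in>seqs n. d xs ss ys) = (\<Sum>w\<in>{1..M}. \<Sum>xs\<in>seqs n. Z xs w w ss ys) / real M"
      unfolding d_def sum_divide_distrib[symmetric] by (subst sum.swap) simp
    also have "(\<Sum>w\<in>{1..M}. \<Sum>xs\<in>seqs n. Z xs w w ss ys) = (\<Sum>w\<in>{1..M}. \<Sum>xs\<in>seqs n. Z xs w 1 ss0 ys)"
      using M by (intro sum.cong refl NS_causal_code_C2[OF Z] that ss0) auto
    also have "\<dots> = (\<Sum>xs\<in>seqs n. \<Sum>w\<in>{1..M}. Z xs w 1 ss0 ys)" by (rule sum.swap)
    also have "\<dots> = 1" using M by (intro NS_causal_code_sum[OF Z] that ss0) auto
    finally show ?thesis .
  qed

  define \<eta> where "\<eta> ss = (\<Sum>xs\<in>seqs n. \<Sum>ys\<in>seqs n. d xs ss ys * ?A xs ss ys)" for ss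
  have succ: "success_prob N P M n Z = (\<Sum>ss\<in>seqs n. PSn P ss * \<eta> ss)"
  proof -
    have "success_prob N P M n Z = (\<Sum>w\<in>{1..M}. \<Sum>ss\<in>seqs n. \<Sum>xs\<in>seqs n. \<Sum>ys\<in>seqs n.
        PSn P ss * ?A xs ss ys * Z xs w w ss ys / real M)"
      unfolding success_prob_def
      by (simp add: sum_distrib_left) (intro sum.cong refl sum.swap)
    also have "\<dots> = (\<Sum>ss\<in>seqs n. \<Sum>xs\<in>seqs n. \<Sum>ys\<in>seqs n. \<Sum>w\<in>{1..M}.
        PSn P ss * ?A xs ss ys * Z xs w w ss ys / real M)"
      by (subst sum.swap, intro sum.cong refl, subst sum.swap, intro sum.cong refl, rule sum.swap)
    also have "\<dots> = (\<Sum>ss\<in>seqs n. PSn P ss * \<eta> ss)"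
      unfolding \<eta>_def d_def sum_distrib_left sum_distrib_right sum_divide_distrib
      by (intro sum.cong refl) (simp add: mult_ac)
    finally show ?thesis .
  qed
  have main: "ln (real M) * \<eta> ss - 1 \<le> (\<Sum>s\<leftarrow>ss. C s)" if ss: "ss \<in> seqs n" for ss
  proof -
    have "(\<Sum>xs\<in>seqs n. \<Sum>ys\<in>seqs n. ln (real M) * (d xs ss ys * ?A xs ss ys) + p xs ss * ?A xs ss ys
          - p xs ss * ?B ss ys - real M * (d xs ss ys * ?B ss ys))
        \<le> (\<Sum>xs\<in>seqs n. \<Sum>ys\<in>seqs n. p xs ss * (?A xs ss ys * ln (?A xs ss ys / ?B ss ys)))"
      using ss M
      by (intro sum_mono tangent_bound Nn_nonneg is_distr_nonneg[OF N'] output_prob_seq_nonneg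
          d_nonneg d_le) (auto intro: output_prob_seq_pos)
    also have "\<dots> \<le> (\<Sum>xs\<in>seqs n. p xs ss * (\<Sum>s\<leftarrow>ss. C s))"
      unfolding sum_distrib_left[symmetric]
      using divergence_seq_le ss order_trans[OF d_nonneg d_le] ys0
      by (intro sum_mono mult_left_mono) auto
    also have "\<dots> = (\<Sum>s\<leftarrow>ss. C s)" by (simp add: p_sum ss flip: sum_distrib_right)
    \<comment> \<open>The four sums are \<open>ln M\<close> times \<open>\<eta> ss\<close>, then
      \<open>1\<close>, \<open>1\<close> and \<open>M * (1 / M)\<close>; the last one is the
      additive \<open>1\<close> of the bound.\<close>
    also have "(\<Sum>xs\<in>seqs n. \<Sum>ys\<in>seqs n. ln (real M) * (d xs ss ys * ?A xs ss ys) + p xs ss * ?A xs ss ys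
          - p xs ss * ?B ss ys - real M * (d xs ss ys * ?B ss ys))
        = ln (real M) * \<eta> ss + (\<Sum>xs\<in>seqs n. p xs ss * (\<Sum>ys\<in>seqs n. ?A xs ss ys))
          - (\<Sum>xs\<in>seqs n. p xs ss * (\<Sum>ys\<in>seqs n. ?B ss ys))
          - real M * (\<Sum>ys\<in>seqs n. (\<Sum>xs\<in>seqs n. d xs ss ys) * ?B ss ys)"
      unfolding \<eta>_def sum_distrib_left sum_distrib_right
      by (simp add: sum_subtractf sum.distrib) (rule sum.swap)
    also have "(\<Sum>xs\<in>seqs n. p xs ss * (\<Sum>ys\<in>seqs n. ?A xs ss ys)) = 1"
      by (simp add: sum_Nn[OF N _ ss] p_sum ss)
    also have "(\<Sum>xs\<in>seqs n. p xs ss * (\<Sum>ys\<in>seqs n. ?B ss ys)) = 1"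
      by (simp add: sum_output_prob_seq p_sum ss)
    also have "(\<Sum>ys\<in>seqs n. (\<Sum>xs\<in>seqs n. d xs ss ys) * ?B ss ys) = 1 / real M"
      by (simp add: d_sum ss sum_output_prob_seq flip: sum_divide_distrib)
    finally show ?thesis using M by simp
  qed
  have "success_prob N P M n Z * ln (real M) - 1 = (\<Sum>ss\<in>seqs n. PSn P ss * (ln (real M) * \<eta> ss - 1))"
    by (simp add: succ right_diff_distrib sum_subtractf sum_PSn is_distr_sum[OF P] sum_distrib_left mult_ac)
  also have "\<dots> \<le> (\<Sum>ss\<in>seqs n. PSn P ss * (\<Sum>s\<leftarrow>ss. C s))"
    by (intro sum_mono mult_left_mono main PSn_nonneg is_distr_nonneg[OF P])
  also have "\<dots> = real n * (\<Sum>s\<in>UNIV. P s * C s)" by (rule sum_PSn_additive[OF P])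
  finally show ?thesis by simp
qed

lemma achievable_NS_causal_le:
  assumes P: "is_distr P" and R: "achievable_NS_causal N P R"
  shows "R \<le> (\<Sum>s\<in>UNIV. P s * C s) / ln 2"
proof -
  define D where "D = (\<Sum>s\<in>UNIV. P s * C s)"
  obtain M L and Z :: "nat \<Rightarrow> 'x list \<Rightarrow> nat \<Rightarrow> nat \<Rightarrow> 's list \<Rightarrow> 'y list \<Rightarrow> real"
    where M: "\<And>n. M n \<ge> 1" and Z: "\<And>n. NS_causal_code (M n) n (Z n)"
      and succ: "(\<lambda>n. success_prob N P (M n) n (Z n)) \<longlonglongrightarrow> 1"
      and lim: "(\<lambda>n. log 2 (real (M n)) / real n) \<longlonglongrightarrow> L" and L: "R \<le> L"
    using R unfolding achievable_NS_causal_def by blast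
  have "(\<lambda>n. success_prob N P (M n) n (Z n) * (log 2 (real (M n)) / real n)) \<longlonglongrightarrow> 1 * L"
    by (intro tendsto_mult succ lim)
  moreover have "(\<lambda>n. (D + 1 / real n) / ln 2) \<longlonglongrightarrow> (D + 0) / ln 2"
    by (intro tendsto_intros lim_1_over_n) auto
  moreover have "eventually (\<lambda>n. success_prob N P (M n) n (Z n) * (log 2 (real (M n)) / real n)
      \<le> (D + 1 / real n) / ln 2) sequentially"
    using eventually_gt_at_top[of 0]
  proof eventually_elim
    case (elim n)
    have "success_prob N P (M n) n (Z n) * ln (real (M n)) / (real n * ln 2)
        \<le> (real n * D + 1) / (real n * ln 2)"
      unfolding D_def by (intro divide_right_mono success_prob_converse P M Z) simp
    also have "\<dots> = (D + 1 / real n) / ln 2" using elim by (simp add: field_simps)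
    finally show ?case by (simp add: log_def mult_ac)
  qed
  ultimately have "1 * L \<le> (D + 0) / ln 2" by (intro tendsto_le[OF sequentially_bot])
  thus ?thesis using L by (simp add: D_def)
qed

end

theorem theorem1:
  fixes N :: "'x::finite \<Rightarrow> 's::finite \<Rightarrow> 'y::finite \<Rightarrow> real"
    and PS :: "'s \<Rightarrow> real"
  assumes "is_channel N" and "is_distr PS"
  shows "(\<exists>Q. (\<forall>s. is_distr (Q s)) \<and> capacity_NS_causal N PS = cond_mutual_info N PS Q) \<and>
         (\<forall>Q. (\<forall>s. is_distr (Q s)) \<longrightarrow> cond_mutual_info N PS Q \<le> capacity_NS_causal N PS)"
proof -
  have N': "is_distr (N x s)" for x s using assms(1) by (simp add: is_channel_def)
  \<comment> \<open>Conditioning on the state decouples the maximization, so an optimal input law is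
    chosen for each \<open>s\<close> on its own.\<close>
  have "\<forall>s. \<exists>P. is_distr P \<and>
      (\<forall>P'. is_distr P' \<longrightarrow> mutual_info (\<lambda>x. N x s) P' \<le> mutual_info (\<lambda>x. N x s) P)"
    by (intro allI exists_mutual_info_maximizer N')
  then obtain Q where Q: "\<And>s. is_distr (Q s)"
    and Q_max: "\<And>s P'. is_distr P' \<Longrightarrow> mutual_info (\<lambda>x. N x s) P' \<le> mutual_info (\<lambda>x. N x s) (Q s)"
    by metis
  interpret reference_output N "\<lambda>s. output_prob (\<lambda>x. N x s) (Q s)"
    "\<lambda>s. mutual_info (\<lambda>x. N x s) (Q s)"
    using mutual_info_maximizer_KKT[of "\<lambda>x. N x s" "Q s" for s, OF N' Q Q_max]
    by unfold_locales (auto intro: assms is_distr_output_prob N' Q)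
  have upper: "R \<le> cond_mutual_info N PS Q" if "achievable_NS_causal N PS R" for R
    using achievable_NS_causal_le[OF assms(2) that] by (simp add: cond_mutual_info_eq assms Q)
  hence bdd: "bdd_above {R. achievable_NS_causal N PS R}" by (intro bdd_aboveI[of _ "cond_mutual_info N PS Q"]) auto
  have lower: "cond_mutual_info N PS Q' \<le> capacity_NS_causal N PS" if Q': "\<And>s. is_distr (Q' s)" for Q'
  proof (rule dense_le)
    fix R assume R: "R < cond_mutual_info N PS Q'"
    \<comment> \<open>Achievable rates are nonnegative, so a negative \<open>R\<close> is replaced
      by \<open>0\<close>.\<close>
    have "achievable_NS_causal N PS (max R 0)"
    proof (cases "R \<ge> 0")
      case True
      thus ?thesis using R by (simp add: achievable_below_cond_mutual_info[OF assms Q'])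
    next
      case False
      thus ?thesis by (simp add: achievable_NS_causal_0 assms)
    qed
    hence "max R 0 \<le> capacity_NS_causal N PS"
      unfolding capacity_NS_causal_def by (intro cSup_upper bdd) auto
    thus "R \<le> capacity_NS_causal N PS" by simp
  qed
  have "capacity_NS_causal N PS \<le> cond_mutual_info N PS Q"
    unfolding capacity_NS_causal_def
    using achievable_NS_causal_0[OF assms] upper by (intro cSup_least) auto
  with lower Q show ?thesis by (meson order_antisym)
qed

end
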